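(* Let $(M,g)$ be an oriented 2-dimensional Riemannian ($e=1$) or Lorentzian ($e=-1$) manifold with Gauss curvature $K$, and let $X_a$ be a 1-form satisfying $$\nabla_{(a}X_{b)}+X_aX_b-\tfrac{K}{2}g_{ab}=0 .$$ Put $F=\epsilon^{ab}\nabla_aX_b$, $\sigma=X_aX^a$, and $$M=\nabla_aK\nabla^aK,\quad \rho=\epsilon^{ab}\nabla_aK\nabla_bM,\quad N=\nabla_aK\nabla^aM,\quad \mu=\tfrac{\Delta K}{6}+\tfrac{K^2}{2},\quad J=\rho+8KFM,$$ $$A=\tfrac e2F^2-\sigma K-\mu,\qquad B=2A^2-KM-6eAF^2-2AK^2+4AK\sigma-2\sigma M-2\nabla^aK\nabla_a\mu .$$ Then, wherever $J\neq0$ and $M\neq0$, $$X_a=\frac{AN-MB}{M(\rho+8KFM)}\,\epsilon_{ab}\nabla^bK+\frac AM\nabla_aK .$$ Moreover, there $\sigma$ satisfies $$MJ^2\sigma=e(AN-MB)^2+A^2J^2,$$ which (as $A$ is linear and $B$ quadratic in $\sigma$) is a quartic polynomial equation for $\sigma$ whose coefficients involve $F$ and invariants of the metric.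
   Context: Abstract index notation; $\nabla$ is the Levi-Civita connection of $g$, indices are raised and lowered with $g$, round brackets denote symmetrisation (with factor $\tfrac12$), $\Delta=\nabla^a\nabla_a$. The Ricci tensor is $R_{ab}=Kg_{ab}$, so the equation is the generalised Ricci soliton equation $\nabla_{(a}X_{b)}+c_1X_aX_b-c_2R_{ab}=\lambda g_{ab}$ with $(c_1,c_2,\lambda)=(1,\tfrac12,0)$. The volume form $\epsilon_{ab}$ satisfies $\epsilon^{ab}\epsilon_{ac}=e\,\delta^b{}_c$ with $e=1$ in Riemannian and $e=-1$ in Lorentzian signature. (The symbol $M$ is used both for the manifold and for the function $\nabla_aK\nabla^aK$; in the formulas it is the function.) *)

theory Defs
  imports "HOL-Analysis.Analysis" "HOL-Computational_Algebra.Polynomial"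
begin

section \<open>Partial derivatives and smoothness on the coordinate plane\<close>

definition partial :: "2 \<Rightarrow> (real^2 \<Rightarrow> real) \<Rightarrow> real^2 \<Rightarrow> real" where
  "partial i f x = frechet_derivative f (at x) (axis i 1)"

text \<open>\<open>C\<^sup>\<infinity>\<close> on an open set: every iterated partial derivative exists and is
  (totally) differentiable there.\<close>

definition smooth_fun_on :: "(real^2) set \<Rightarrow> (real^2 \<Rightarrow> real) \<Rightarrow> bool" where
  "smooth_fun_on S f \<longleftrightarrow> (\<forall>is. \<forall>x\<in>S. (fold partial is f) differentiable (at x))"

section \<open>Oriented smooth surfaces\<close>

text \<open>A chart is a pair \<open>(U, \<phi>)\<close> of an open set of points and a coordinate map. The surface
  is the union of the chart domains, an open subset of the ambient (Hausdorff, second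
  countable) type; the orientation is given by requiring that all coordinate changes have
  positive Jacobian determinant.\<close>

type_synonym 'a chart = "'a set \<times> ('a \<Rightarrow> real^2)"

definition coord_domain :: "'a chart \<Rightarrow> (real^2) set" where
  "coord_domain c = snd c ` fst c"

definition transition :: "'a chart \<Rightarrow> 'a chart \<Rightarrow> real^2 \<Rightarrow> real^2" where
  "transition c c' = snd c' \<circ> inv_into (fst c) (snd c)"

definition overlap :: "'a chart \<Rightarrow> 'a chart \<Rightarrow> (real^2) set" where
  "overlap c c' = snd c ` (fst c \<inter> fst c')"

definition oriented_surface ::
  "'a::{t2_space, second_countable_topology} chart set \<Rightarrow> bool" where
  "oriented_surface \<A> \<longleftrightarrow>
     (\<forall>c\<in>\<A>. open (fst c) \<and> open (coord_domain c) \<and>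
        homeomorphism (fst c) (coord_domain c) (snd c) (inv_into (fst c) (snd c))) \<and>
     (\<forall>c\<in>\<A>. \<forall>c'\<in>\<A>.
        (\<forall>i. smooth_fun_on (overlap c c') (\<lambda>x. transition c c' x $ i)) \<and>
        (\<forall>x\<in>overlap c c'. det (jacobian (transition c c') (at x)) > 0))"

section \<open>Tensor fields\<close>

text \<open>A tensor field is a family of component functions, one for each chart, defined on the
  coordinate domain of that chart and obeying the tensorial transformation law on overlaps.\<close>

definition one_form ::
  "'a::{t2_space, second_countable_topology} chart set \<Rightarrow> ('a chart \<Rightarrow> real^2 \<Rightarrow> real^2) \<Rightarrow> bool"
  where
  "one_form \<A> X \<longleftrightarrow>
     (\<forall>c\<in>\<A>. \<forall>i. smooth_fun_on (coord_domain c) (\<lambda>x. X c x $ i)) \<and>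
     (\<forall>c\<in>\<A>. \<forall>c'\<in>\<A>. \<forall>x\<in>overlap c c'.
        X c x = transpose (jacobian (transition c c') (at x)) *v X c' (transition c c' x))"

definition symmetric_2_tensor ::
  "'a::{t2_space, second_countable_topology} chart set \<Rightarrow> ('a chart \<Rightarrow> real^2 \<Rightarrow> real^2^2) \<Rightarrow> bool"
  where
  "symmetric_2_tensor \<A> g \<longleftrightarrow>
     (\<forall>c\<in>\<A>. \<forall>i j. smooth_fun_on (coord_domain c) (\<lambda>x. g c x $ i $ j)) \<and>
     (\<forall>c\<in>\<A>. \<forall>x\<in>coord_domain c. transpose (g c x) = g c x) \<and>
     (\<forall>c\<in>\<A>. \<forall>c'\<in>\<A>. \<forall>x\<in>overlap c c'.
        g c x = transpose (jacobian (transition c c') (at x))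
                  ** g c' (transition c c' x) ** jacobian (transition c c') (at x))"

definition riemannian_metric ::
  "'a::{t2_space, second_countable_topology} chart set \<Rightarrow> ('a chart \<Rightarrow> real^2 \<Rightarrow> real^2^2) \<Rightarrow> bool"
  where
  "riemannian_metric \<A> g \<longleftrightarrow> symmetric_2_tensor \<A> g \<and>
     (\<forall>c\<in>\<A>. \<forall>x\<in>coord_domain c. \<forall>v. v \<noteq> 0 \<longrightarrow> v \<bullet> (g c x *v v) > 0)"

text \<open>Signature \<open>(1,1)\<close>: every tangent space has an orthonormal frame with one spacelike and
  one timelike vector; in particular the metric is nondegenerate.\<close>

definition lorentzian_metric ::
  "'a::{t2_space, second_countable_topology} chart set \<Rightarrow> ('a chart \<Rightarrow> real^2 \<Rightarrow> real^2^2) \<Rightarrow> bool"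
  where
  "lorentzian_metric \<A> g \<longleftrightarrow> symmetric_2_tensor \<A> g \<and>
     (\<forall>c\<in>\<A>. \<forall>x\<in>coord_domain c. \<exists>u v.
        u \<bullet> (g c x *v u) = 1 \<and> v \<bullet> (g c x *v v) = -1 \<and> u \<bullet> (g c x *v v) = 0)"

section \<open>Metric calculus in a chart\<close>

text \<open>Below, \<open>G\<close> is the component matrix of the metric in an oriented chart.\<close>

definition christoffel :: "(real^2 \<Rightarrow> real^2^2) \<Rightarrow> real^2 \<Rightarrow> 2 \<Rightarrow> 2 \<Rightarrow> 2 \<Rightarrow> real" where
  \<comment> \<open>\<open>christoffel G x k i j\<close> is the symbol with upper index \<open>k\<close> and lower indices \<open>i, j\<close>\<close>
  "christoffel G x k i j = (1/2) * (\<Sum>l\<in>UNIV. matrix_inv (G x) $ k $ l *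
     (partial i (\<lambda>y. G y $ l $ j) x + partial j (\<lambda>y. G y $ l $ i) x
      - partial l (\<lambda>y. G y $ i $ j) x))"

definition nabla :: "(real^2 \<Rightarrow> real^2^2) \<Rightarrow> (real^2 \<Rightarrow> real^2) \<Rightarrow> real^2 \<Rightarrow> 2 \<Rightarrow> 2 \<Rightarrow> real" where
  \<comment> \<open>\<open>nabla G \<omega> x a b\<close> is the component \<open>\<nabla>\<^sub>a \<omega>\<^sub>b\<close> of the covariant derivative of a 1-form\<close>
  "nabla G \<omega> x a b =
     partial a (\<lambda>y. \<omega> y $ b) x - (\<Sum>k\<in>UNIV. christoffel G x k a b * \<omega> x $ k)"

definition riemann :: "(real^2 \<Rightarrow> real^2^2) \<Rightarrow> real^2 \<Rightarrow> 2 \<Rightarrow> 2 \<Rightarrow> 2 \<Rightarrow> 2 \<Rightarrow> real" where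
  \<comment> \<open>\<open>riemann G x a b c d\<close> has \<open>c\<close> as its upper index, with the convention
      \<open>(\<nabla>\<^sub>a \<nabla>\<^sub>b - \<nabla>\<^sub>b \<nabla>\<^sub>a) Z\<^sup>c = (\<Sum>d. riemann G x a b c d * Z\<^sup>d)\<close>\<close>
  "riemann G x a b c d =
     partial a (\<lambda>y. christoffel G y c b d) x - partial b (\<lambda>y. christoffel G y c a d) x
     + (\<Sum>k\<in>UNIV. christoffel G x c a k * christoffel G x k b d
                  - christoffel G x c b k * christoffel G x k a d)"

text \<open>Sectional curvature of the tangent plane. With the above convention for the Riemann
  tensor this is the sign and normalisation for which the Ricci tensor is \<open>K g\<close>, in either
  signature; the round Riemannian unit sphere has \<open>K = 1\<close>.\<close>

definition gauss_curvature :: "(real^2 \<Rightarrow> real^2^2) \<Rightarrow> real^2 \<Rightarrow> real" where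
  "gauss_curvature G x =
     (\<Sum>k\<in>UNIV. G x $ 1 $ k * riemann G x 1 2 k 2) / det (G x)"

definition grad :: "(real^2 \<Rightarrow> real) \<Rightarrow> real^2 \<Rightarrow> real^2" where
  \<comment> \<open>the covariant components \<open>\<nabla>\<^sub>a f\<close>\<close>
  "grad f x = (\<chi> a. partial a f x)"

definition raise :: "(real^2 \<Rightarrow> real^2^2) \<Rightarrow> real^2 \<Rightarrow> real^2 \<Rightarrow> real^2" where
  "raise G x \<omega> = matrix_inv (G x) *v \<omega>"

definition contract :: "(real^2 \<Rightarrow> real^2^2) \<Rightarrow> real^2 \<Rightarrow> real^2 \<Rightarrow> real^2 \<Rightarrow> real" where
  \<comment> \<open>\<open>\<omega>\<^sub>a \<eta>\<^sup>a\<close>\<close>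
  "contract G x \<omega> \<eta> = (\<Sum>a\<in>UNIV. \<omega> $ a * raise G x \<eta> $ a)"

definition laplacian :: "(real^2 \<Rightarrow> real^2^2) \<Rightarrow> (real^2 \<Rightarrow> real) \<Rightarrow> real^2 \<Rightarrow> real" where
  "laplacian G f x =
     (\<Sum>a\<in>UNIV. \<Sum>b\<in>UNIV. matrix_inv (G x) $ a $ b * nabla G (grad f) x a b)"

definition vol :: "(real^2 \<Rightarrow> real^2^2) \<Rightarrow> real^2 \<Rightarrow> 2 \<Rightarrow> 2 \<Rightarrow> real" where
  \<comment> \<open>the volume form \<open>\<epsilon>\<^sub>a\<^sub>b\<close>, positive on the oriented coordinate frame\<close>
  "vol G x a b = sqrt \<bar>det (G x)\<bar> * (if a = b then 0 else if a = 1 then 1 else -1)"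

definition vol_up :: "(real^2 \<Rightarrow> real^2^2) \<Rightarrow> real^2 \<Rightarrow> 2 \<Rightarrow> 2 \<Rightarrow> real" where
  \<comment> \<open>both indices raised with the metric; hence \<open>\<epsilon>\<^sup>a\<^sup>b \<epsilon>\<^sub>a\<^sub>c = e \<delta>\<^sup>b\<^sub>c\<close> with \<open>e\<close> the sign of
      the determinant of the metric\<close>
  "vol_up G x a b = (\<Sum>c\<in>UNIV. \<Sum>d\<in>UNIV.
     matrix_inv (G x) $ a $ c * matrix_inv (G x) $ b $ d * vol G x c d)"

end

theory Submission
  imports Defs
begin

text \<open>
  The statement is local, and the argument is the prolongation of the soliton equation in a chart.
  The equation fixes the symmetric part of \<open>\<nabla>X\<close>; adding the scalar \<open>F\<close>, which is the
  antisymmetric part, as an unknown prescribes every first derivative of \<open>X\<close>: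
  \<open>\<nabla>\<^sub>a X\<^sub>b = - X\<^sub>a X\<^sub>b + K/2 g\<^sub>a\<^sub>b + e F/2 \<epsilon>\<^sub>a\<^sub>b\<close> (\<open>nabla_X\<close>). Commuting derivatives of \<open>X\<close> and inserting
  the two-dimensional Riemann tensor (\<open>riemann_eq\<close>) prescribes the derivative of \<open>F\<close> as well
  (\<open>partial_curl\<close>), so the system is closed, and its compatibility conditions are algebraic.

  Commuting derivatives of \<open>F\<close> gives the first of them, \<open>X\<^sup>a \<nabla>\<^sub>a K = A\<close> (\<open>curl_integrability\<close>).
  Differentiating it along the gradient of \<open>K\<close> gives the second,
  \<open>X\<^sup>a \<nabla>\<^sub>a M = B + 8 e F K \<epsilon>\<^sub>a\<^sub>b X\<^sup>a \<nabla>\<^sup>b K\<close> (\<open>curvature_transport\<close>). Write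
  \<open>X\<^sub>a = \<alpha> \<epsilon>\<^sub>a\<^sub>b \<nabla>\<^sup>b K + \<beta> \<nabla>\<^sub>a K\<close>, which is possible where \<open>M \<noteq> 0\<close>. The first condition gives
  \<open>\<beta> = A / M\<close> and then the second one \<open>\<alpha> M J = A N - M B\<close>. This is the formula for \<open>X\<close>, and
  \<open>\<sigma> = e \<alpha>\<^sup>2 M + \<beta>\<^sup>2 M\<close> is the quartic relation (\<open>solve_in_gradient_frame\<close>). As
  \<open>B\<close> has the coefficient \<open>- 2 K\<^sup>2\<close> at \<open>\<sigma>\<^sup>2\<close>, this relation has degree four in \<open>\<sigma>\<close> where \<open>K \<noteq> 0\<close>
  (\<open>quartic_polynomial\<close>).

  The computations in coordinates require that the mixed partial derivatives of a smooth function
  agree (\<open>partial_commute\<close>) and that the smooth functions are closed under the field operations.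
\<close>

section \<open>Calculus of smooth functions on the plane\<close>

lemma partial_eqI: "(f has_derivative D) (at x) \<Longrightarrow> partial i f x = D (axis i 1)"
  unfolding partial_def by (metis frechet_derivative_at)

lemma partial_cong_open:
  assumes "open S" "x \<in> S" "\<And>y. y \<in> S \<Longrightarrow> f y = g y"
  shows "partial i f x = partial i g x"
proof -
  have "(f has_derivative D) (at x) \<longleftrightarrow> (g has_derivative D) (at x)" for D
    using has_derivative_transform_within_open[OF _ assms(1,2), of f D UNIV g]
      has_derivative_transform_within_open[OF _ assms(1,2), of g D UNIV f] assms(3) by auto
  then show ?thesis
    unfolding partial_def frechet_derivative_def by simp
qed

lemma differentiable_cong_open:
  assumes "open S" "x \<in> S" "\<And>y. y \<in> S \<Longrightarrow> f y = g y" "f differentiable (at x)"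
  shows "g differentiable (at x)"
proof -
  from assms(4) obtain D where "(f has_derivative D) (at x)"
    unfolding differentiable_def by blast
  then have "(g has_derivative D) (at x)"
    by (rule has_derivative_transform_within_open[OF _ assms(1,2)]) (rule assms(3))
  then show ?thesis
    unfolding differentiable_def by blast
qed

lemma has_derivative_frechet:
  "f differentiable (at x) \<Longrightarrow> (f has_derivative frechet_derivative f (at x)) (at x)"
  by (simp add: frechet_derivative_works)

lemma partial_const [simp]: "partial i (\<lambda>y. c) x = 0"
  by (rule partial_eqI[THEN trans]) (auto intro: has_derivative_const)

lemma partial_add_at:
  assumes "f differentiable (at x)" "g differentiable (at x)"
  shows "partial i (\<lambda>y. f y + g y) x = partial i f x + partial i g x"
  by (rule partial_eqI[THEN trans, OF has_derivative_add[OF assms[THEN has_derivative_frechet]]])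
     (simp add: partial_def)

lemma partial_mult_at:
  assumes "f differentiable (at x)" "g differentiable (at x)"
  shows "partial i (\<lambda>y. f y * g y) x = partial i f x * g x + f x * partial i g x"
  by (rule partial_eqI[THEN trans, OF has_derivative_mult[OF assms[THEN has_derivative_frechet]]])
     (simp add: partial_def)

lemma partial_inverse_at:
  assumes "f differentiable (at x)" "f x \<noteq> 0"
  shows "partial i (\<lambda>y. inverse (f y)) x = - 1 * (partial i f x * (inverse (f x) * inverse (f x)))"
  by (rule partial_eqI[THEN trans, OF Deriv.has_derivative_inverse[OF assms(2) assms(1)[THEN has_derivative_frechet]]])
     (simp add: partial_def)

text \<open>Smoothness quantifies over all lists of derivatives at once, which is awkward for the product
  rule: one step turns a product into a sum of two products. Counting the available derivatives
  instead gives an induction in which the hypothesis covers all functions of lower order.\<close>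

primrec differentiable_upto :: "nat \<Rightarrow> (real^2) set \<Rightarrow> (real^2 \<Rightarrow> real) \<Rightarrow> bool" where
  "differentiable_upto 0 S f \<longleftrightarrow> (\<forall>x\<in>S. f differentiable (at x))"
| "differentiable_upto (Suc k) S f \<longleftrightarrow>
     (\<forall>x\<in>S. f differentiable (at x)) \<and> (\<forall>i. differentiable_upto k S (partial i f))"

lemma differentiable_upto_imp: "differentiable_upto k S f \<Longrightarrow> x \<in> S \<Longrightarrow> f differentiable (at x)"
  by (cases k) auto

lemma differentiable_upto_partial:
  "differentiable_upto (Suc k) S f \<Longrightarrow> differentiable_upto k S (partial i f)"
  by simp

lemma differentiable_upto_0I:
  "(\<And>x. x \<in> S \<Longrightarrow> f differentiable (at x)) \<Longrightarrow> differentiable_upto 0 S f"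
  by simp

lemma differentiable_upto_SucI:
  "(\<And>x. x \<in> S \<Longrightarrow> f differentiable (at x)) \<Longrightarrow> (\<And>i. differentiable_upto k S (partial i f))
    \<Longrightarrow> differentiable_upto (Suc k) S f"
  by simp

lemma differentiable_upto_lower: "differentiable_upto (Suc k) S f \<Longrightarrow> differentiable_upto k S f"
  by (induction k arbitrary: f) simp_all

lemma smooth_differentiable:
  assumes "smooth_fun_on S f" "x \<in> S"
  shows "f differentiable (at x)"
proof -
  have "fold partial [] f differentiable (at x)"
    using assms unfolding smooth_fun_on_def by blast
  then show ?thesis by simp
qed

lemma smooth_partial:
  assumes "smooth_fun_on S f"
  shows "smooth_fun_on S (partial i f)"
  unfolding smooth_fun_on_def
proof (intro allI ballI)
  fix "is" x assume "x \<in> S"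
  then have "fold partial (i # is) f differentiable (at x)"
    using assms unfolding smooth_fun_on_def by blast
  then show "fold partial is (partial i f) differentiable (at x)" by simp
qed

lemma smooth_fun_on_iff_upto: "smooth_fun_on S f \<longleftrightarrow> (\<forall>k. differentiable_upto k S f)"
proof
  have "differentiable_upto k S h" if "smooth_fun_on S h" for k h
    using that by (induction k arbitrary: h) (simp_all add: smooth_differentiable smooth_partial)
  then show "smooth_fun_on S f \<Longrightarrow> \<forall>k. differentiable_upto k S f" by blast
next
  assume f: "\<forall>k. differentiable_upto k S f"
  have "\<forall>x\<in>S. fold partial is h differentiable (at x)" if "differentiable_upto (length is) S h" for "is" h
    using that by (induction "is" arbitrary: h) simp_all
  then show "smooth_fun_on S f" using f unfolding smooth_fun_on_def by blast
qed

lemma differentiable_upto_cong: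
  assumes "open S" "\<And>y. y \<in> S \<Longrightarrow> f y = g y" "differentiable_upto k S f"
  shows "differentiable_upto k S g"
  using assms(2,3)
proof (induction k arbitrary: f g)
  case 0
  then show ?case using differentiable_cong_open[OF \<open>open S\<close>] by (metis differentiable_upto.simps(1))
next
  case (Suc k)
  have "differentiable_upto k S (partial i g)" for i
  proof (rule Suc.IH)
    show "partial i f y = partial i g y" if "y \<in> S" for y
      by (rule partial_cong_open[OF \<open>open S\<close> that Suc.prems(1)])
    show "differentiable_upto k S (partial i f)"
      using Suc.prems(2) by simp
  qed
  moreover have "g differentiable (at y)" if "y \<in> S" for y
    by (rule differentiable_cong_open[OF \<open>open S\<close> that Suc.prems(1) differentiable_upto_imp[OF Suc.prems(2) that]])
  ultimately show ?case by simp
qed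

lemma differentiable_upto_const: "differentiable_upto k S (\<lambda>y. c)"
proof (induction k arbitrary: c)
  case (Suc k)
  have "partial i (\<lambda>y. c) = (\<lambda>y. 0)" for i by (rule ext) (rule partial_const)
  then show ?case using Suc by simp
qed simp

lemma differentiable_upto_add:
  assumes "open S" "differentiable_upto k S f" "differentiable_upto k S g"
  shows "differentiable_upto k S (\<lambda>y. f y + g y)"
  using assms(2,3)
proof (induction k arbitrary: f g)
  case 0
  show ?case
    by (intro differentiable_upto_0I differentiable_add) (rule 0[THEN differentiable_upto_imp], assumption)+
next
  case (Suc k)
  note diff = Suc.prems[THEN differentiable_upto_imp]
  show ?case
  proof (rule differentiable_upto_SucI)
    show "(\<lambda>y. f y + g y) differentiable (at x)" if "x \<in> S" for x
      by (intro differentiable_add diff that)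
    show "differentiable_upto k S (partial i (\<lambda>y. f y + g y))" for i
    proof (rule differentiable_upto_cong[OF \<open>open S\<close>])
      show "differentiable_upto k S (\<lambda>y. partial i f y + partial i g y)"
        by (rule Suc.IH[OF Suc.prems[THEN differentiable_upto_partial]])
      show "partial i f y + partial i g y = partial i (\<lambda>y. f y + g y) y" if "y \<in> S" for y
        by (rule partial_add_at[OF diff[OF that], symmetric])
    qed
  qed
qed

lemma differentiable_upto_mult:
  assumes "open S" "differentiable_upto k S f" "differentiable_upto k S g"
  shows "differentiable_upto k S (\<lambda>y. f y * g y)"
  using assms(2,3)
proof (induction k arbitrary: f g)
  case 0
  show ?case
    by (intro differentiable_upto_0I differentiable_mult) (rule 0[THEN differentiable_upto_imp], assumption)+
next
  case (Suc k)
  note diff = Suc.prems[THEN differentiable_upto_imp]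
  show ?case
  proof (rule differentiable_upto_SucI)
    show "(\<lambda>y. f y * g y) differentiable (at x)" if "x \<in> S" for x
      by (intro differentiable_mult diff that)
    show "differentiable_upto k S (partial i (\<lambda>y. f y * g y))" for i
    proof (rule differentiable_upto_cong[OF \<open>open S\<close>])
      show "differentiable_upto k S (\<lambda>y. partial i f y * g y + f y * partial i g y)"
        by (rule differentiable_upto_add[OF \<open>open S\<close>]; rule Suc.IH)
           (rule Suc.prems[THEN differentiable_upto_partial] Suc.prems[THEN differentiable_upto_lower])+
      show "partial i f y * g y + f y * partial i g y = partial i (\<lambda>y. f y * g y) y" if "y \<in> S" for y
        by (rule partial_mult_at[OF diff[OF that], symmetric])
    qed
  qed
qed

lemma differentiable_upto_inverse:
  assumes S: "open S" and nz: "\<And>y. y \<in> S \<Longrightarrow> f y \<noteq> 0" and f: "differentiable_upto k S f"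
  shows "differentiable_upto k S (\<lambda>y. inverse (f y))"
  using f
proof (induction k)
  case 0
  show ?case
    by (intro differentiable_upto_0I differentiable_inverse nz differentiable_upto_imp[OF 0])
next
  case (Suc k)
  note diff = Suc.prems[THEN differentiable_upto_imp]
  show ?case
  proof (rule differentiable_upto_SucI)
    show "(\<lambda>y. inverse (f y)) differentiable (at x)" if "x \<in> S" for x
      by (intro differentiable_inverse diff nz that)
    show "differentiable_upto k S (partial i (\<lambda>y. inverse (f y)))" for i
    proof (rule differentiable_upto_cong[OF S])
      show "differentiable_upto k S (\<lambda>y. - 1 * (partial i f y * (inverse (f y) * inverse (f y))))"
        by (intro differentiable_upto_mult differentiable_upto_const S
            Suc.IH[OF differentiable_upto_lower[OF Suc.prems]] differentiable_upto_partial[OF Suc.prems])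
      show "- 1 * (partial i f y * (inverse (f y) * inverse (f y))) = partial i (\<lambda>y. inverse (f y)) y"
        if "y \<in> S" for y
        by (rule partial_inverse_at[OF diff[OF that] nz[OF that], symmetric])
    qed
  qed
qed

text \<open>The mixed partial derivatives are compared through the second difference of \<open>f\<close> over a small
  square. Applying the mean value theorem first along one edge and then along the other
  expresses it by either of the two mixed derivatives at points of the square; shrinking the
  square and using their continuity yields equality at the corner.\<close>

lemma axis_curve_derivative:
  assumes "f differentiable (at (a + t *\<^sub>R axis i 1))"
  shows "((\<lambda>s. f (a + s *\<^sub>R axis i 1)) has_real_derivative partial i f (a + t *\<^sub>R axis i 1)) (at t)"
proof -
  let ?D = "frechet_derivative f (at (a + t *\<^sub>R axis i 1))"
  have "((\<lambda>s. a + s *\<^sub>R axis i (1::real)) has_derivative (\<lambda>s. s *\<^sub>R axis i 1)) (at t)"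
    by (auto intro!: derivative_eq_intros)
  from diff_chain_at[OF this has_derivative_frechet[OF assms]]
  have "((\<lambda>s. f (a + s *\<^sub>R axis i 1)) has_derivative (\<lambda>s. ?D (s *\<^sub>R axis i 1))) (at t)"
    by (simp add: o_def)
  moreover have "?D (s *\<^sub>R axis i 1) = partial i f (a + t *\<^sub>R axis i 1) * s" for s
    using linear_frechet_derivative[OF assms] by (simp add: linear_cmul partial_def)
  ultimately show ?thesis by (simp add: has_field_derivative_def)
qed

lemma second_difference_mean_value:
  assumes f: "\<And>y. y \<in> ball x r \<Longrightarrow> f differentiable (at y)"
    and fi: "\<And>y. y \<in> ball x r \<Longrightarrow> partial i f differentiable (at y)"
    and h: "0 < h" "2 * h < r"
  shows "\<exists>p. dist x p < 2 * h \<and>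
    f (x + h *\<^sub>R axis i 1 + h *\<^sub>R axis j 1) - f (x + h *\<^sub>R axis i 1) - f (x + h *\<^sub>R axis j 1) + f x
      = h * h * partial j (partial i f) p"
proof -
  let ?u = "axis i (1::real)" and ?v = "axis j (1::real)"
  have dist: "dist x (x + s *\<^sub>R ?u + t *\<^sub>R ?v) \<le> s + t" if "0 \<le> s" "0 \<le> t" for s t
  proof -
    have "dist x (x + s *\<^sub>R ?u + t *\<^sub>R ?v) = norm (s *\<^sub>R ?u + t *\<^sub>R ?v)"
      by (metis add.assoc add_diff_cancel_left' dist_commute dist_norm)
    then show ?thesis
      using norm_triangle_ineq[of "s *\<^sub>R ?u" "t *\<^sub>R ?v"] that by simp
  qed
  have inb: "x + s *\<^sub>R ?u + t *\<^sub>R ?v \<in> ball x r" if "0 \<le> s" "s \<le> h" "0 \<le> t" "t \<le> h" for s t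
    using dist[of s t] that h by simp
  define \<phi> where "\<phi> s = f (x + h *\<^sub>R ?v + s *\<^sub>R ?u) - f (x + s *\<^sub>R ?u)" for s
  have "(\<phi> has_real_derivative
      partial i f (x + h *\<^sub>R ?v + s *\<^sub>R ?u) - partial i f (x + s *\<^sub>R ?u)) (at s)"
    if "0 \<le> s" "s \<le> h" for s
    unfolding \<phi>_def using inb[of s h] inb[of s 0] that h
    by (intro DERIV_diff axis_curve_derivative f) (auto simp: add_ac)
  from MVT2[OF h(1) this] obtain s where s: "0 < s" "s < h"
    and 1: "\<phi> h - \<phi> 0 = h * (partial i f (x + h *\<^sub>R ?v + s *\<^sub>R ?u) - partial i f (x + s *\<^sub>R ?u))"
    by auto
  have "((\<lambda>t. partial i f (x + s *\<^sub>R ?u + t *\<^sub>R ?v)) has_real_derivative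
      partial j (partial i f) (x + s *\<^sub>R ?u + t *\<^sub>R ?v)) (at t)" if "0 \<le> t" "t \<le> h" for t
    using inb[of s t] that s by (intro axis_curve_derivative fi) auto
  from MVT2[OF h(1) this] obtain t where t: "0 < t" "t < h"
    and 2: "partial i f (x + s *\<^sub>R ?u + h *\<^sub>R ?v) - partial i f (x + s *\<^sub>R ?u)
      = h * partial j (partial i f) (x + s *\<^sub>R ?u + t *\<^sub>R ?v)"
    by auto
  have "\<phi> h - \<phi> 0 = h * h * partial j (partial i f) (x + s *\<^sub>R ?u + t *\<^sub>R ?v)"
    using 1 2 by (simp add: add_ac)
  then show ?thesis
    using dist[of s t] s t unfolding \<phi>_def
    by (intro exI[of _ "x + s *\<^sub>R ?u + t *\<^sub>R ?v"]) (auto simp: add_ac)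
qed

lemma partial_commute:
  assumes S: "open S" "x \<in> S" and f: "smooth_fun_on S f"
  shows "partial i (partial j f) x = partial j (partial i f) x"
proof -
  obtain r where r: "0 < r" "ball x r \<subseteq> S"
    using S openE by blast
  have diff: "g differentiable (at y)" if "smooth_fun_on S g" "y \<in> ball x r" for g y
    using that r smooth_differentiable by blast
  note smooth = f smooth_partial[OF f] smooth_partial[OF smooth_partial[OF f]]
  define h where "h n = r / 4 * inverse (real (Suc n))" for n
  have h: "0 < h n" "2 * h n < r" for n
    using r by (auto simp: h_def divide_simps)
  have "\<exists>p q. dist x p < 2 * h n \<and> dist x q < 2 * h n \<and>
      partial i (partial j f) p = partial j (partial i f) q" for n
  proof -
    obtain p where p: "dist x p < 2 * h n" "f (x + h n *\<^sub>R axis j 1 + h n *\<^sub>R axis i 1)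
        - f (x + h n *\<^sub>R axis j 1) - f (x + h n *\<^sub>R axis i 1) + f x = h n * h n * partial i (partial j f) p"
      using second_difference_mean_value[of x r f j "h n" i] diff smooth h by blast
    obtain q where q: "dist x q < 2 * h n" "f (x + h n *\<^sub>R axis i 1 + h n *\<^sub>R axis j 1)
        - f (x + h n *\<^sub>R axis i 1) - f (x + h n *\<^sub>R axis j 1) + f x = h n * h n * partial j (partial i f) q"
      using second_difference_mean_value[of x r f i "h n" j] diff smooth h by blast
    have "h n * h n * partial i (partial j f) p = h n * h n * partial j (partial i f) q"
      unfolding p(2)[symmetric] q(2)[symmetric] by (simp add: add_ac)
    then show ?thesis using p(1) q(1) h(1)[of n] by auto
  qed
  then obtain p q where pq: "\<And>n. dist x (p n) < 2 * h n" "\<And>n. dist x (q n) < 2 * h n"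
      "\<And>n. partial i (partial j f) (p n) = partial j (partial i f) (q n)"
    by metis
  have "(\<lambda>n. (r / 2) * inverse (real (Suc n))) \<longlonglongrightarrow> (r / 2) * 0"
    by (intro tendsto_mult tendsto_const LIMSEQ_inverse_real_of_nat)
  then have h0: "(\<lambda>n. 2 * h n) \<longlonglongrightarrow> 0"
    by (simp add: h_def)
  have lim: "u \<longlonglongrightarrow> x" if "\<And>n. dist x (u n) < 2 * h n" for u
  proof (rule metric_tendsto_imp_tendsto[OF h0])
    have "dist (u n) x \<le> dist (2 * h n) 0" for n
      using that[of n] by (simp add: dist_commute)
    then show "\<forall>\<^sub>F n in sequentially. dist (u n) x \<le> dist (2 * h n) 0"
      by (rule always_eventually[OF allI])
  qed
  have cont: "isCont (partial k (partial l f)) x" for k l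
    using smooth(3) S differentiable_imp_continuous_within smooth_differentiable by blast
  have "(\<lambda>n. partial i (partial j f) (p n)) \<longlonglongrightarrow> partial i (partial j f) x"
    by (rule isCont_tendsto_compose[OF cont lim[OF pq(1)]])
  moreover have "(\<lambda>n. partial i (partial j f) (p n)) \<longlonglongrightarrow> partial j (partial i f) x"
    unfolding pq(3) by (rule isCont_tendsto_compose[OF cont lim[OF pq(2)]])
  ultimately show ?thesis by (rule LIMSEQ_unique)
qed

lemma smooth_const: "smooth_fun_on S (\<lambda>y. c)"
  by (simp add: smooth_fun_on_iff_upto differentiable_upto_const)

lemma smooth_cong:
  "open S \<Longrightarrow> (\<And>y. y \<in> S \<Longrightarrow> f y = g y) \<Longrightarrow> smooth_fun_on S f \<Longrightarrow> smooth_fun_on S g"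
  unfolding smooth_fun_on_iff_upto using differentiable_upto_cong by blast

lemma smooth_add:
  "open S \<Longrightarrow> smooth_fun_on S f \<Longrightarrow> smooth_fun_on S g \<Longrightarrow> smooth_fun_on S (\<lambda>y. f y + g y)"
  by (simp add: smooth_fun_on_iff_upto differentiable_upto_add)

lemma smooth_mult:
  "open S \<Longrightarrow> smooth_fun_on S f \<Longrightarrow> smooth_fun_on S g \<Longrightarrow> smooth_fun_on S (\<lambda>y. f y * g y)"
  by (simp add: smooth_fun_on_iff_upto differentiable_upto_mult)

lemma smooth_diff:
  assumes "open S" "smooth_fun_on S f" "smooth_fun_on S g"
  shows "smooth_fun_on S (\<lambda>y. f y - g y)"
  using smooth_add[OF assms(1,2) smooth_mult[OF assms(1) smooth_const[of S "-1"] assms(3)]] by simp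

lemma smooth_divide:
  assumes "open S" "\<And>y. y \<in> S \<Longrightarrow> g y \<noteq> 0" "smooth_fun_on S f" "smooth_fun_on S g"
  shows "smooth_fun_on S (\<lambda>y. f y / g y)"
proof -
  have "smooth_fun_on S (\<lambda>y. inverse (g y))"
    using assms by (simp add: smooth_fun_on_iff_upto differentiable_upto_inverse)
  from smooth_mult[OF assms(1,3) this] show ?thesis by (simp add: divide_inverse)
qed

lemma smooth_power: "open S \<Longrightarrow> smooth_fun_on S f \<Longrightarrow> smooth_fun_on S (\<lambda>y. (f y)\<^sup>2)"
  unfolding power2_eq_square by (rule smooth_mult)

lemma matrix_inv_2:
  fixes M :: "real^2^2"
  assumes "det M \<noteq> 0"
  shows "matrix_inv M $ 1 $ 1 = M $ 2 $ 2 / det M" "matrix_inv M $ 1 $ 2 = - M $ 1 $ 2 / det M"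
    "matrix_inv M $ 2 $ 1 = - M $ 2 $ 1 / det M" "matrix_inv M $ 2 $ 2 = M $ 1 $ 1 / det M"
proof -
  define D where "D = det M"
  define N :: "real^2^2" where
    "N = vector [vector [M$2$2 / D, - M$1$2 / D], vector [- M$2$1 / D, M$1$1 / D]]"
  have D: "D \<noteq> 0" "M$1$1 * M$2$2 - M$1$2 * M$2$1 = D"
    using assms by (simp_all add: D_def det_2)
  have "M$1$1 * (M$2$2 / D) + M$1$2 * (- M$2$1 / D) = 1" "M$2$1 * (- M$1$2 / D) + M$2$2 * (M$1$1 / D) = 1"
    using D by (simp_all add: field_simps)
  then have "M ** N = mat 1"
    unfolding matrix_matrix_mult_def mat_def N_def vec_eq_iff forall_2
    by (simp add: sum_2 vector_2)
  moreover have "M ** matrix_inv M = mat 1" "matrix_inv M ** M = mat 1"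
    using assms someI_ex[of "\<lambda>N. M ** N = mat 1 \<and> N ** M = mat 1"]
    by (simp_all add: invertible_det_nz[symmetric] invertible_def matrix_inv_def)
  ultimately have "matrix_inv M = N"
    by (metis matrix_mul_assoc matrix_mul_lid matrix_mul_rid)
  then show "matrix_inv M $ 1 $ 1 = M $ 2 $ 2 / det M" "matrix_inv M $ 1 $ 2 = - M $ 1 $ 2 / det M"
    "matrix_inv M $ 2 $ 1 = - M $ 2 $ 1 / det M" "matrix_inv M $ 2 $ 2 = M $ 1 $ 1 / det M"
    by (simp_all add: N_def vector_2 D_def)
qed

section \<open>The metric and its curvature in a chart\<close>

text \<open>One signed parameter treats both signatures: \<open>e\<close> is the sign of the determinant of the metric,
  so \<open>\<bar>det G\<bar> = e det G\<close>.\<close>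

locale metric_chart =
  fixes U :: "(real^2) set" and G :: "real^2 \<Rightarrow> real^2^2" and e :: real
  assumes U: "open U"
    and smooth_G: "\<And>i j. smooth_fun_on U (\<lambda>y. G y $ i $ j)"
    and G_sym: "\<And>y i j. y \<in> U \<Longrightarrow> G y $ i $ j = G y $ j $ i"
    and e: "e = 1 \<or> e = -1"
    and e_det: "\<And>y. y \<in> U \<Longrightarrow> e * det (G y) > 0"
begin

lemma det_nz: "y \<in> U \<Longrightarrow> det (G y) \<noteq> 0"
  using e_det by force

lemma G_21: "y \<in> U \<Longrightarrow> G y $ 2 $ 1 = G y $ 1 $ 2"
  by (rule G_sym)

lemma det_G: "y \<in> U \<Longrightarrow> det (G y) = G y $ 1 $ 1 * G y $ 2 $ 2 - (G y $ 1 $ 2)\<^sup>2"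
  by (simp add: det_2 G_21 power2_eq_square)

lemma partial_add [simp]:
  "\<lbrakk>x \<in> U; smooth_fun_on U f; smooth_fun_on U g\<rbrakk> \<Longrightarrow> partial i (\<lambda>y. f y + g y) x = partial i f x + partial i g x"
  by (intro partial_add_at smooth_differentiable)

lemma partial_mult [simp]:
  "\<lbrakk>x \<in> U; smooth_fun_on U f; smooth_fun_on U g\<rbrakk> \<Longrightarrow>
    partial i (\<lambda>y. f y * g y) x = partial i f x * g x + f x * partial i g x"
  by (intro partial_mult_at smooth_differentiable)

lemma partial_diff [simp]:
  assumes "x \<in> U" "smooth_fun_on U f" "smooth_fun_on U g"
  shows "partial i (\<lambda>y. f y - g y) x = partial i f x - partial i g x"
  using partial_add[OF assms(1,2) smooth_mult[OF U smooth_const[of U "-1"] assms(3)], of i]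
    partial_mult[OF assms(1) smooth_const[of U "-1"] assms(3), of i] by simp

lemma partial_divide:
  assumes "x \<in> U" "\<And>y. y \<in> U \<Longrightarrow> g y \<noteq> 0" "smooth_fun_on U f" "smooth_fun_on U g"
  shows "partial i (\<lambda>y. f y / g y) x = (partial i f x - f x / g x * partial i g x) / g x"
proof -
  let ?q = "\<lambda>y. f y / g y"
  have "partial i f x = partial i (\<lambda>y. ?q y * g y) x"
    by (rule partial_cong_open[OF U assms(1)]) (simp add: assms(2))
  also have "\<dots> = partial i ?q x * g x + ?q x * partial i g x"
    by (rule partial_mult[OF assms(1) smooth_divide[OF U assms(2,3,4)] assms(4)])
  finally show ?thesis using assms(1,2) by (simp add: field_simps)
qed

lemma smooth_cdivide [intro, simp]: "smooth_fun_on U f \<Longrightarrow> smooth_fun_on U (\<lambda>y. f y / c)"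
  using smooth_mult[OF U smooth_const[of U "1/c"], of f] by simp

lemma partial_cdivide [simp]:
  assumes "x \<in> U" "smooth_fun_on U f"
  shows "partial i (\<lambda>y. f y / c) x = partial i f x / c"
  using partial_mult[OF assms(1) smooth_const[of U "1/c"] assms(2), of i] by simp

lemma partial_power2 [simp]:
  "\<lbrakk>x \<in> U; smooth_fun_on U f\<rbrakk> \<Longrightarrow> partial i (\<lambda>y. (f y)\<^sup>2) x = 2 * f x * partial i f x"
  unfolding power2_eq_square by simp

lemmas smooth_intros [intro, simp] =
  smooth_const smooth_add[OF U] smooth_mult[OF U] smooth_diff[OF U] smooth_power[OF U] smooth_partial smooth_G

lemma smooth_det [intro, simp]: "smooth_fun_on U (\<lambda>y. det (G y))"
  unfolding det_2 by (intro smooth_intros)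

lemma matrix_inv_G:
  assumes "y \<in> U"
  shows "matrix_inv (G y) $ 1 $ 1 = G y $ 2 $ 2 / det (G y)"
    "matrix_inv (G y) $ 1 $ 2 = - G y $ 1 $ 2 / det (G y)"
    "matrix_inv (G y) $ 2 $ 1 = - G y $ 1 $ 2 / det (G y)"
    "matrix_inv (G y) $ 2 $ 2 = G y $ 1 $ 1 / det (G y)"
  using matrix_inv_2[OF det_nz[OF assms]] G_21[OF assms] by simp_all

lemma smooth_matrix_inv [intro, simp]: "smooth_fun_on U (\<lambda>y. matrix_inv (G y) $ i $ j)"
proof -
  have q: "smooth_fun_on U (\<lambda>y. c * G y $ k $ l / det (G y))" for c k l
    by (intro smooth_divide[OF U det_nz]) auto
  have "smooth_fun_on U (\<lambda>y. matrix_inv (G y) $ 1 $ 1)" "smooth_fun_on U (\<lambda>y. matrix_inv (G y) $ 1 $ 2)"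
    "smooth_fun_on U (\<lambda>y. matrix_inv (G y) $ 2 $ 1)" "smooth_fun_on U (\<lambda>y. matrix_inv (G y) $ 2 $ 2)"
    using smooth_cong[OF U _ q[of 1 2 2]] smooth_cong[OF U _ q[of "-1" 1 2]] smooth_cong[OF U _ q[of 1 1 1]]
    by (simp_all add: matrix_inv_G)
  then show ?thesis
    using exhaust_2[of i] exhaust_2[of j] by auto
qed

lemma smooth_christoffel [intro, simp]: "smooth_fun_on U (\<lambda>y. christoffel G y k i j)"
  unfolding christoffel_def sum_2 by (intro smooth_intros smooth_matrix_inv)

lemma smooth_riemann [intro, simp]: "smooth_fun_on U (\<lambda>y. riemann G y a b c d)"
  unfolding riemann_def sum_2 by (intro smooth_intros smooth_christoffel)

lemma smooth_curvature [intro, simp]: "smooth_fun_on U (gauss_curvature G)"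
proof -
  have "smooth_fun_on U (\<lambda>y. (G y $ 1 $ 1 * riemann G y 1 2 1 2 + G y $ 1 $ 2 * riemann G y 1 2 2 2) / det (G y))"
    by (intro smooth_divide[OF U det_nz]) auto
  then show ?thesis
    by (rule smooth_cong[OF U, rotated]) (simp add: gauss_curvature_def sum_2)
qed

lemma partial_G_21: "x \<in> U \<Longrightarrow> partial k (\<lambda>y. G y $ 2 $ 1) x = partial k (\<lambda>y. G y $ 1 $ 2) x"
  by (rule partial_cong_open[OF U _ G_21])

lemma christoffel_21: "x \<in> U \<Longrightarrow> christoffel G x k 2 1 = christoffel G x k 1 2"
  by (simp add: christoffel_def sum_2 partial_G_21 add.commute)

lemma partial_christoffel_21:
  "x \<in> U \<Longrightarrow> partial i (\<lambda>y. christoffel G y k 2 1) x = partial i (\<lambda>y. christoffel G y k 1 2) x"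
  by (rule partial_cong_open[OF U _ christoffel_21])

text \<open>Lowering the upper index of the Christoffel symbol cancels the inverse metric and leaves
  first derivatives of the metric; in the sum over the two slots only the one along \<open>k\<close> survives.\<close>

lemma metric_compatible:
  assumes "x \<in> U"
  shows "partial k (\<lambda>y. G y $ i $ j) x =
    (\<Sum>l\<in>UNIV. christoffel G x l k i * G x $ l $ j + christoffel G x l k j * G x $ i $ l)"
proof -
  have solve: "(1/2 * (r / D * A + - q / D * B)) * p + (1/2 * (- q / D * A + p / D * B)) * q = A / 2"
      "(1/2 * (r / D * A + - q / D * B)) * q + (1/2 * (- q / D * A + p / D * B)) * r = B / 2"
    if "D \<noteq> 0" "D = p * r - q\<^sup>2" for A B p q r D :: real
  proof -
    have "(1/2 * (r / D * A + - q / D * B)) * p + (1/2 * (- q / D * A + p / D * B)) * q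
        = (p * r - q\<^sup>2) * A / D / 2"
      using that(1) by (simp add: field_simps power2_eq_square)
    then show "(1/2 * (r / D * A + - q / D * B)) * p + (1/2 * (- q / D * A + p / D * B)) * q = A / 2"
      using that by simp
    have "(1/2 * (r / D * A + - q / D * B)) * q + (1/2 * (- q / D * A + p / D * B)) * r
        = (p * r - q\<^sup>2) * B / D / 2"
      using that(1) by (simp add: field_simps power2_eq_square)
    then show "(1/2 * (r / D * A + - q / D * B)) * q + (1/2 * (- q / D * A + p / D * B)) * r = B / 2"
      using that by simp
  qed
  have lower: "(\<Sum>l\<in>UNIV. christoffel G x l a b * G x $ l $ c) =
      (partial a (\<lambda>y. G y $ c $ b) x + partial b (\<lambda>y. G y $ c $ a) x - partial c (\<lambda>y. G y $ a $ b) x) / 2" for a b c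
    unfolding christoffel_def sum_2 matrix_inv_G[OF assms]
    using exhaust_2[of c] solve[OF det_nz[OF assms] det_G[OF assms]] G_21[OF assms] by auto
  have G_sym': "partial a (\<lambda>y. G y $ b $ c) x = partial a (\<lambda>y. G y $ c $ b) x" for a b c
    by (rule partial_cong_open[OF U assms G_sym])
  have "(\<Sum>l\<in>UNIV. christoffel G x l k i * G x $ l $ j + christoffel G x l k j * G x $ i $ l)
      = (\<Sum>l\<in>UNIV. christoffel G x l k i * G x $ l $ j) + (\<Sum>l\<in>UNIV. christoffel G x l k j * G x $ l $ i)"
    by (simp add: sum.distrib G_sym[OF assms, of i])
  also have "\<dots> = partial k (\<lambda>y. G y $ i $ j) x"
    unfolding lower G_sym'[of k j i] G_sym'[of i j k] G_sym'[of j i k] by (simp add: field_simps)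
  finally show ?thesis by (rule sym)
qed

text \<open>The Riemann tensor arises here as the obstruction to commuting the two derivatives of the
  metric components, each rewritten by compatibility of the connection. As they do commute,
  the part of the lowered tensor that is symmetric in its last two indices must vanish.\<close>

lemma riemann_lowered_antisym:
  assumes x: "x \<in> U"
  shows "(\<Sum>k\<in>UNIV. G x $ c $ k * riemann G x 1 2 k d) = - (\<Sum>k\<in>UNIV. G x $ d $ k * riemann G x 1 2 k c)"
proof -
  let ?C = "christoffel G"
  have second: "partial a (partial b (\<lambda>y. G y $ i $ j)) x =
      partial a (\<lambda>y. \<Sum>l\<in>UNIV. ?C y l b i * G y $ l $ j + ?C y l b j * G y $ i $ l) x" for a b i j
    by (rule partial_cong_open[OF U x metric_compatible])
  have "partial 1 (partial 2 (\<lambda>y. G y $ c $ d)) x = partial 2 (partial 1 (\<lambda>y. G y $ c $ d)) x"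
    by (rule partial_commute[OF U x smooth_G])
  then have "0 = partial 1 (partial 2 (\<lambda>y. G y $ c $ d)) x - partial 2 (partial 1 (\<lambda>y. G y $ c $ d)) x"
    by simp
  also have "\<dots> = (\<Sum>k\<in>UNIV. G x $ c $ k * riemann G x 1 2 k d) + (\<Sum>k\<in>UNIV. G x $ d $ k * riemann G x 1 2 k c)"
    unfolding second riemann_def sum_2 using exhaust_2[of c] exhaust_2[of d]
    by (elim disjE) (simp_all add: x metric_compatible[OF x] sum_2 G_21[OF x] algebra_simps)
  finally show ?thesis by simp
qed

text \<open>In two dimensions an antisymmetric pair of indices has one component. The lowered tensor is
  therefore determined by the Gauss curvature, and raising the index again gives
  \<open>R\<^sub>a\<^sub>b\<^sup>c\<^sub>d = K (\<delta>\<^sub>a\<^sup>c g\<^sub>b\<^sub>d - \<delta>\<^sub>b\<^sup>c g\<^sub>a\<^sub>d)\<close>.\<close>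

lemma riemann_eq:
  assumes x: "x \<in> U"
  shows "riemann G x 1 2 1 1 = gauss_curvature G x * G x $ 1 $ 2"
    "riemann G x 1 2 2 1 = - gauss_curvature G x * G x $ 1 $ 1"
    "riemann G x 1 2 1 2 = gauss_curvature G x * G x $ 2 $ 2"
    "riemann G x 1 2 2 2 = - gauss_curvature G x * G x $ 1 $ 2"
proof -
  define p q r K where "p = G x $ 1 $ 1" and "q = G x $ 1 $ 2" and "r = G x $ 2 $ 2"
    and "K = gauss_curvature G x"
  define R where "R k d = riemann G x 1 2 k d" for k d
  have d: "p * r - q\<^sup>2 \<noteq> 0"
    using det_nz det_G x unfolding p_def q_def r_def by simp
  have "p * R 1 2 + q * R 2 2 = K * (p * r - q\<^sup>2)"
    using det_nz[OF x] det_G[OF x] unfolding K_def gauss_curvature_def sum_2 p_def q_def r_def R_def by simp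
  moreover have "q * R 1 1 + r * R 2 1 = - (p * R 1 2 + q * R 2 2)"
    "p * R 1 1 + q * R 2 1 = - (p * R 1 1 + q * R 2 1)"
    "q * R 1 2 + r * R 2 2 = - (q * R 1 2 + r * R 2 2)"
    using riemann_lowered_antisym[OF x, of 2 1] riemann_lowered_antisym[OF x, of 1 1]
      riemann_lowered_antisym[OF x, of 2 2]
    unfolding sum_2 G_21[OF x] p_def q_def r_def R_def by simp_all
  ultimately have "(p * r - q\<^sup>2) * R 1 1 = (p * r - q\<^sup>2) * (K * q)"
    "(p * r - q\<^sup>2) * R 2 1 = (p * r - q\<^sup>2) * (- K * p)"
    "(p * r - q\<^sup>2) * R 1 2 = (p * r - q\<^sup>2) * (K * r)"
    "(p * r - q\<^sup>2) * R 2 2 = (p * r - q\<^sup>2) * (- K * q)"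
    by algebra+
  then have "R 1 1 = K * q" "R 2 1 = - K * p" "R 1 2 = K * r" "R 2 2 = - K * q"
    by (simp_all only: mult_left_cancel[OF d])
  then show "riemann G x 1 2 1 1 = gauss_curvature G x * G x $ 1 $ 2"
    "riemann G x 1 2 2 1 = - gauss_curvature G x * G x $ 1 $ 1"
    "riemann G x 1 2 1 2 = gauss_curvature G x * G x $ 2 $ 2"
    "riemann G x 1 2 2 2 = - gauss_curvature G x * G x $ 1 $ 2"
    unfolding p_def q_def r_def R_def K_def .
qed

end

context metric_chart
begin

lemma contract_eq:
  assumes "y \<in> U"
  shows "contract G y \<omega> \<eta> = (G y $ 2 $ 2 * \<omega> $ 1 * \<eta> $ 1 - G y $ 1 $ 2 * (\<omega> $ 1 * \<eta> $ 2 + \<omega> $ 2 * \<eta> $ 1)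
    + G y $ 1 $ 1 * \<omega> $ 2 * \<eta> $ 2) / det (G y)"
  using det_nz[OF assms]
  by (simp add: contract_def raise_def matrix_vector_mult_def sum_2 matrix_inv_G[OF assms] field_simps)

lemma contract_commute: "y \<in> U \<Longrightarrow> contract G y \<omega> \<eta> = contract G y \<eta> \<omega>"
  by (simp add: contract_eq algebra_simps)

lemma lower_raise:
  assumes "y \<in> U"
  shows "\<omega> $ i = G y $ i $ 1 * raise G y \<omega> $ 1 + G y $ i $ 2 * raise G y \<omega> $ 2"
proof -
  have "det (G y) * \<omega> $ i = det (G y) * (G y $ i $ 1 * raise G y \<omega> $ 1 + G y $ i $ 2 * raise G y \<omega> $ 2)"
    unfolding raise_def matrix_vector_mult_def using exhaust_2[of i] det_nz[OF assms]
    by (elim disjE)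
      (simp_all add: sum_2 matrix_inv_G[OF assms] G_21[OF assms] distrib_left divide_simps,
       simp_all add: det_G[OF assms] power2_eq_square algebra_simps)
  then show ?thesis using det_nz[OF assms] by simp
qed

lemma partial_det:
  assumes "x \<in> U"
  shows "partial k (\<lambda>y. det (G y)) x = 2 * (christoffel G x 1 k 1 + christoffel G x 2 k 2) * det (G x)"
  using assms unfolding det_2 by (simp add: metric_compatible sum_2 G_21 algebra_simps)

lemma smooth_nabla:
  assumes "\<And>i. smooth_fun_on U (\<lambda>y. \<omega> y $ i)"
  shows "smooth_fun_on U (\<lambda>y. nabla G \<omega> y a b)"
  unfolding nabla_def sum_2 using assms by (intro smooth_intros smooth_christoffel)

lemma smooth_contract:
  assumes "\<And>i. smooth_fun_on U (\<lambda>y. \<omega> y $ i)" "\<And>i. smooth_fun_on U (\<lambda>y. \<eta> y $ i)"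
  shows "smooth_fun_on U (\<lambda>y. contract G y (\<omega> y) (\<eta> y))"
  unfolding contract_def raise_def matrix_vector_mult_def using assms
  by (simp add: sum_2)

text \<open>The contraction is a polynomial in the components divided by the determinant. The trace of the
  connection that appears when the polynomial is differentiated is exactly compensated by the
  derivative of the determinant.\<close>

lemma partial_contract:
  assumes x: "x \<in> U"
    and sm: "\<And>i. smooth_fun_on U (\<lambda>y. \<omega> y $ i)" "\<And>i. smooth_fun_on U (\<lambda>y. \<eta> y $ i)"
  shows "partial k (\<lambda>y. contract G y (\<omega> y) (\<eta> y)) x =
    contract G x (\<chi> b. nabla G \<omega> x k b) (\<eta> x) + contract G x (\<omega> x) (\<chi> b. nabla G \<eta> x k b)"
proof -
  let ?Q = "\<lambda>y a b. G y $ 2 $ 2 * a $ 1 * b $ 1 - G y $ 1 $ 2 * (a $ 1 * b $ 2 + a $ 2 * b $ 1)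
    + G y $ 1 $ 1 * a $ 2 * b $ 2"
  have sQ: "smooth_fun_on U (\<lambda>y. ?Q y (\<omega> y) (\<eta> y))"
    by (simp add: sm)
  have "partial k (\<lambda>y. contract G y (\<omega> y) (\<eta> y)) x = partial k (\<lambda>y. ?Q y (\<omega> y) (\<eta> y) / det (G y)) x"
    by (rule partial_cong_open[OF U x contract_eq])
  also have "\<dots> = (partial k (\<lambda>y. ?Q y (\<omega> y) (\<eta> y)) x
      - ?Q x (\<omega> x) (\<eta> x) / det (G x) * partial k (\<lambda>y. det (G y)) x) / det (G x)"
    by (rule partial_divide[OF x det_nz sQ smooth_det])
  also have "partial k (\<lambda>y. ?Q y (\<omega> y) (\<eta> y)) x =
      ?Q x (\<chi> b. nabla G \<omega> x k b) (\<eta> x) + ?Q x (\<omega> x) (\<chi> b. nabla G \<eta> x k b)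
      + 2 * (christoffel G x 1 k 1 + christoffel G x 2 k 2) * ?Q x (\<omega> x) (\<eta> x)"
    using x by (simp add: sm nabla_def sum_2 metric_compatible G_21 algebra_simps)
  finally show ?thesis
    using det_nz[OF x] by (simp add: contract_eq[OF x] partial_det[OF x] field_simps)
qed

lemma smooth_grad: "smooth_fun_on U f \<Longrightarrow> smooth_fun_on U (\<lambda>y. grad f y $ i)"
  by (simp add: grad_def smooth_partial)

lemma grad_nth: "grad f y $ k = partial k f y"
  by (simp add: grad_def)

lemma smooth_laplacian: "smooth_fun_on U f \<Longrightarrow> smooth_fun_on U (\<lambda>y. laplacian G f y)"
  unfolding laplacian_def sum_2
  by (intro smooth_intros smooth_matrix_inv smooth_nabla smooth_grad)

lemma hessian_sym:
  assumes "x \<in> U" "smooth_fun_on U f"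
  shows "nabla G (grad f) x 2 1 = nabla G (grad f) x 1 2"
  using partial_commute[OF U assms, of 1 2] 
  by (simp add: nabla_def sum_2 grad_def christoffel_21[OF assms(1)])

lemma vol_up_eq:
  assumes "x \<in> U"
  shows "(\<Sum>a\<in>UNIV. \<Sum>b\<in>UNIV. vol_up G x a b * t a b) = sqrt \<bar>det (G x)\<bar> / det (G x) * (t 1 2 - t 2 1)"
proof -
  have D: "G x $ 2 $ 2 / D * (G x $ 1 $ 1 / D) - - G x $ 1 $ 2 / D * (- G x $ 1 $ 2 / D) = 1 / D"
    if "D \<noteq> 0" "D = G x $ 1 $ 1 * G x $ 2 $ 2 - (G x $ 1 $ 2)\<^sup>2" for D
  proof -
    have "G x $ 2 $ 2 / D * (G x $ 1 $ 1 / D) - - G x $ 1 $ 2 / D * (- G x $ 1 $ 2 / D)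
        = (G x $ 1 $ 1 * G x $ 2 $ 2 - (G x $ 1 $ 2)\<^sup>2) / D / D"
      by (simp add: power2_eq_square diff_divide_distrib)
    then show ?thesis using that by simp
  qed
  let ?h = "\<lambda>i j. matrix_inv (G x) $ i $ j"
  have h: "?h 1 1 * ?h 2 2 - ?h 1 2 * ?h 2 1 = 1 / det (G x)"
    unfolding matrix_inv_G[OF assms] by (rule D[OF det_nz[OF assms] det_G[OF assms]])
  have "vol_up G x 1 1 = 0" "vol_up G x 2 2 = 0"
    by (simp_all add: vol_up_def vol_def sum_2)
  moreover have "vol_up G x 1 2 = sqrt \<bar>det (G x)\<bar> * (?h 1 1 * ?h 2 2 - ?h 1 2 * ?h 2 1)"
    "vol_up G x 2 1 = - (sqrt \<bar>det (G x)\<bar> * (?h 1 1 * ?h 2 2 - ?h 1 2 * ?h 2 1))"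
    by (simp_all add: vol_up_def vol_def sum_2 algebra_simps)
  ultimately show ?thesis by (simp add: h sum_2 algebra_simps diff_divide_distrib)
qed

end

section \<open>Prolongation of the soliton equation\<close>

locale soliton_chart = metric_chart +
  fixes X :: "real^2 \<Rightarrow> real^2"
  assumes smooth_X [intro, simp]: "\<And>i. smooth_fun_on U (\<lambda>y. X y $ i)"
    and soliton: "\<And>x a b. x \<in> U \<Longrightarrow>
      (nabla G X x a b + nabla G X x b a) / 2 + X x $ a * X x $ b - gauss_curvature G x / 2 * G x $ a $ b = 0"
begin

abbreviation K :: "real^2 \<Rightarrow> real" where "K \<equiv> gauss_curvature G"

text \<open>The single component of \<open>dX\<close> in the chart. It is the scalar \<open>F\<close> up to the sign \<open>e\<close> and the density factor
  \<open>sqrt \<bar>det G\<bar>\<close>; working with the density keeps all differentiated expressions rational in the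
  components of the metric.\<close>

definition curl :: "real^2 \<Rightarrow> real" where
  "curl y = partial 1 (\<lambda>z. X z $ 2) y - partial 2 (\<lambda>z. X z $ 1) y"

lemma smooth_curl [intro, simp]: "smooth_fun_on U curl"
  unfolding curl_def[abs_def] by (intro smooth_intros smooth_X)

text \<open>The soliton equation prescribes the symmetric part of \<open>\<nabla>X\<close>, and \<open>curl\<close> names the remaining
  antisymmetric part. With \<open>curl\<close> as a further unknown, the equation thus becomes a first-order
  system in which every derivative of \<open>X\<close> is prescribed.\<close>

lemma nabla_X:
  assumes "x \<in> U"
  shows "nabla G X x 1 1 = - (X x $ 1 * X x $ 1) + K x / 2 * G x $ 1 $ 1"
    "nabla G X x 1 2 = - (X x $ 1 * X x $ 2) + K x / 2 * G x $ 1 $ 2 + curl x / 2"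
    "nabla G X x 2 1 = - (X x $ 1 * X x $ 2) + K x / 2 * G x $ 1 $ 2 - curl x / 2"
    "nabla G X x 2 2 = - (X x $ 2 * X x $ 2) + K x / 2 * G x $ 2 $ 2"
proof -
  have c: "nabla G X x 1 2 - nabla G X x 2 1 = curl x"
    by (simp add: nabla_def curl_def christoffel_21[OF assms] sum_2)
  show "nabla G X x 1 1 = - (X x $ 1 * X x $ 1) + K x / 2 * G x $ 1 $ 1"
    "nabla G X x 1 2 = - (X x $ 1 * X x $ 2) + K x / 2 * G x $ 1 $ 2 + curl x / 2"
    "nabla G X x 2 1 = - (X x $ 1 * X x $ 2) + K x / 2 * G x $ 1 $ 2 - curl x / 2"
    "nabla G X x 2 2 = - (X x $ 2 * X x $ 2) + K x / 2 * G x $ 2 $ 2"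
    using c soliton[OF assms, of 1 1] soliton[OF assms, of 1 2] soliton[OF assms, of 2 2]
    by (simp_all add: field_simps)
qed

lemma partial_X: "partial a (\<lambda>y. X y $ b) x = nabla G X x a b
    + (christoffel G x 1 a b * X x $ 1 + christoffel G x 2 a b * X x $ 2)"
  by (simp add: nabla_def sum_2)

text \<open>The integrability condition of that system. Commuting the derivatives of \<open>X\<close> produces
  a curvature term, known in two dimensions, and the derivative of \<open>curl\<close>; solving for the latter
  closes the system. Invariantly, with \<open>(\<star>Y)\<^sub>c = Y\<^sup>a \<epsilon>\<^sub>a\<^sub>c\<close>,
  this is \<open>dF = -3 F X + \<star>dK + 3 K \<star>X\<close>. The trace of the Christoffel symbol appears because
  \<open>curl\<close> is a density.\<close>

lemma partial_curl:
  assumes x: "x \<in> U"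
  shows "partial i curl x = (christoffel G x 1 i 1 + christoffel G x 2 i 2) * curl x - 3 * curl x * X x $ i
    + (partial 1 K x * G x $ 2 $ i - partial 2 K x * G x $ 1 $ i)
    + 3 * K x * (X x $ 1 * G x $ 2 $ i - X x $ 2 * G x $ 1 $ i)"
proof -
  let ?\<Gamma> = "christoffel G"
  \<comment> \<open>The first-order system, differentiated once more; the coefficients are written as products so
    that the product rule applies.\<close>
  have D: "partial c (partial 1 (\<lambda>y. X y $ 1)) x =
      partial c (\<lambda>y. - 1 * (X y $ 1 * X y $ 1) + 1/2 * K y * G y $ 1 $ 1
        + (?\<Gamma> y 1 1 1 * X y $ 1 + ?\<Gamma> y 2 1 1 * X y $ 2)) x"
    "partial c (partial 1 (\<lambda>y. X y $ 2)) x =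
      partial c (\<lambda>y. - 1 * (X y $ 1 * X y $ 2) + 1/2 * K y * G y $ 1 $ 2 + 1/2 * curl y
        + (?\<Gamma> y 1 1 2 * X y $ 1 + ?\<Gamma> y 2 1 2 * X y $ 2)) x"
    "partial c (partial 2 (\<lambda>y. X y $ 1)) x =
      partial c (\<lambda>y. - 1 * (X y $ 1 * X y $ 2) + 1/2 * K y * G y $ 1 $ 2 - 1/2 * curl y
        + (?\<Gamma> y 1 2 1 * X y $ 1 + ?\<Gamma> y 2 2 1 * X y $ 2)) x"
    "partial c (partial 2 (\<lambda>y. X y $ 2)) x =
      partial c (\<lambda>y. - 1 * (X y $ 2 * X y $ 2) + 1/2 * K y * G y $ 2 $ 2
        + (?\<Gamma> y 1 2 2 * X y $ 1 + ?\<Gamma> y 2 2 2 * X y $ 2)) x" for c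
    by (rule partial_cong_open[OF U x], simp add: partial_X nabla_X)+
  have "0 = 2 * (partial 1 (partial 2 (\<lambda>y. X y $ i)) x - partial 2 (partial 1 (\<lambda>y. X y $ i)) x)"
    using partial_commute[OF U x smooth_X] by simp
  also have "\<dots> = - (partial i curl x - (?\<Gamma> x 1 i 1 + ?\<Gamma> x 2 i 2) * curl x) - 3 * curl x * X x $ i
      + (partial 1 K x * G x $ 2 $ i - partial 2 K x * G x $ 1 $ i)
      + K x * (X x $ 1 * G x $ 2 $ i - X x $ 2 * G x $ 1 $ i)
      + 2 * (X x $ 1 * riemann G x 1 2 1 i + X x $ 2 * riemann G x 1 2 2 i)"
    using exhaust_2[of i]
    by (elim disjE) (simp_all add: D x partial_X nabla_X metric_compatible sum_2 G_21 riemann_def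
        christoffel_21[OF x] partial_christoffel_21[OF x] field_simps)
  also have "X x $ 1 * riemann G x 1 2 1 i + X x $ 2 * riemann G x 1 2 2 i
      = K x * (X x $ 1 * G x $ 2 $ i - X x $ 2 * G x $ 1 $ i)"
    using exhaust_2[of i] by (elim disjE) (simp_all add: riemann_eq[OF x] G_21[OF x] algebra_simps)
  finally show ?thesis by (simp add: algebra_simps)
qed

text \<open>Commuting the derivatives of \<open>curl\<close> gives the first obstruction, which is linear in the
  component of \<open>X\<close> along the gradient of \<open>K\<close>. It is the identity \<open>X\<^sup>a \<nabla>\<^sub>a K = A\<close>, since
  \<open>curl\<^sup>2 / det G = e F\<^sup>2\<close>.\<close>

lemma curl_integrability:
  assumes x: "x \<in> U"
  shows "contract G x (X x) (grad K x) = (curl x)\<^sup>2 / (2 * det (G x)) - contract G x (X x) (X x) * K x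
    - (laplacian G K x / 6 + (K x)\<^sup>2 / 2)"
proof -
  let ?\<Gamma> = "christoffel G" and ?H = "nabla G (grad K) x"
  let ?Q = "\<lambda>a b :: real^2. G x $ 2 $ 2 * a $ 1 * b $ 1 - G x $ 1 $ 2 * (a $ 1 * b $ 2 + a $ 2 * b $ 1)
    + G x $ 1 $ 1 * a $ 2 * b $ 2"
  have D: "partial c (partial i curl) x =
     partial c (\<lambda>y. (?\<Gamma> y 1 i 1 + ?\<Gamma> y 2 i 2) * curl y - 3 * curl y * X y $ i
    + (partial 1 K y * G y $ 2 $ i - partial 2 K y * G y $ 1 $ i)
    + 3 * K y * (X y $ 1 * G y $ 2 $ i - X y $ 2 * G y $ 1 $ i)) x" for c i
    by (rule partial_cong_open[OF U x partial_curl])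
  have "0 = partial 1 (partial 2 curl) x - partial 2 (partial 1 curl) x"
    using partial_commute[OF U x smooth_curl] by simp
  also have "\<dots> = (riemann G x 1 2 1 1 + riemann G x 1 2 2 2) * curl x
      + (G x $ 2 $ 2 * ?H 1 1 - G x $ 1 $ 2 * (?H 1 2 + ?H 2 1) + G x $ 1 $ 1 * ?H 2 2)
      + 6 * ?Q (X x) (grad K x) + 6 * K x * ?Q (X x) (X x)
      + 3 * (K x)\<^sup>2 * det (G x) - 3 * (curl x)\<^sup>2"
    unfolding D
    by (simp add: x partial_curl[OF x] partial_X nabla_X metric_compatible sum_2 G_21 riemann_def grad_def nabla_def[of G "grad K"]
        christoffel_21[OF x] partial_christoffel_21[OF x] partial_G_21[OF x] det_G[OF x] power2_eq_square field_simps)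
  \<comment> \<open>The curvature of the density bundle: a metric connection preserves the volume form.\<close>
  also have "riemann G x 1 2 1 1 + riemann G x 1 2 2 2 = 0"
    by (simp add: riemann_eq[OF x])
  also have "G x $ 2 $ 2 * ?H 1 1 - G x $ 1 $ 2 * (?H 1 2 + ?H 2 1) + G x $ 1 $ 1 * ?H 2 2 = det (G x) * laplacian G K x"
    using det_nz[OF x] by (simp add: laplacian_def sum_2 matrix_inv_G[OF x] field_simps)
  also have "?Q (X x) (grad K x) = det (G x) * contract G x (X x) (grad K x)"
    using det_nz[OF x] by (simp add: contract_eq[OF x])
  also have "?Q (X x) (X x) = det (G x) * contract G x (X x) (X x)"
    using det_nz[OF x] by (simp add: contract_eq[OF x])
  finally show ?thesis using det_nz[OF x] by (simp add: field_simps)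
qed

text \<open>The algebra behind the second obstruction. The variables \<open>x1\<close>, \<open>x2\<close>, \<open>k1\<close>, \<open>k2\<close> are the
  contravariant and \<open>X1\<close>, \<open>X2\<close>, \<open>K1\<close>, \<open>K2\<close> the covariant components of \<open>X\<close> and of the gradient of
  the curvature \<open>K\<close>;
  \<open>H\<close> is the Hessian of the curvature, \<open>m1\<close>, \<open>m2\<close> the gradient of \<open>\<mu>\<close>, and \<open>w\<close>, \<open>v\<close> are \<open>curl\<close> and \<open>e F\<^sup>2\<close>.
  The two assumptions are the components of the differentiated first obstruction; pairing them
  with the gradient \<open>k\<close> turns the Hessian terms into a derivative of \<open>\<nabla>\<^sub>a K \<nabla>\<^sup>a K\<close>.\<close>

lemma transport_combination:
  fixes A M K \<sigma> v w m x1 x2 X1 X2 k1 k2 K1 K2 H11 H12 H22 m1 m2 :: real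
  assumes A: "A = X1 * k1 + X2 * k2" and M: "M = K1 * k1 + K2 * k2" and m: "m = m1 * k1 + m2 * k2"
    and 1: "- X1 * A + K / 2 * K1 + w / 2 * k2 + (H11 * x1 + H12 * x2) =
      - 3 * v * X1 - w * (k2 + 3 * K * x2) - \<sigma> * K1 - 2 * (- X1 * \<sigma> + K / 2 * X1 + w / 2 * x2) * K - m1"
    and 2: "- X2 * A + K / 2 * K2 - w / 2 * k1 + (H12 * x1 + H22 * x2) =
      - 3 * v * X2 + w * (k1 + 3 * K * x1) - \<sigma> * K2 - 2 * (- X2 * \<sigma> + K / 2 * X2 - w / 2 * x1) * K - m2"
  shows "2 * (H11 * k1 + H12 * k2) * x1 + 2 * (H12 * k1 + H22 * k2) * x2 =
    2 * A\<^sup>2 - K * M - 6 * A * v - 2 * A * K\<^sup>2 + 4 * A * K * \<sigma> - 2 * \<sigma> * M - 2 * m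
    + 8 * w * K * (x1 * k2 - x2 * k1)"
proof -
  have "2 * (H11 * k1 + H12 * k2) * x1 + 2 * (H12 * k1 + H22 * k2) * x2 =
      2 * (k1 * (H11 * x1 + H12 * x2) + k2 * (H12 * x1 + H22 * x2))"
    by (simp add: algebra_simps)
  also have "H11 * x1 + H12 * x2 = X1 * A - K / 2 * K1 - w / 2 * k2
      - 3 * v * X1 - w * (k2 + 3 * K * x2) - \<sigma> * K1 - 2 * (- X1 * \<sigma> + K / 2 * X1 + w / 2 * x2) * K - m1"
    using 1 by simp
  also have "H12 * x1 + H22 * x2 = X2 * A - K / 2 * K2 + w / 2 * k1
      - 3 * v * X2 + w * (k1 + 3 * K * x1) - \<sigma> * K2 - 2 * (- X2 * \<sigma> + K / 2 * X2 - w / 2 * x1) * K - m2"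
    using 2 by simp
  finally show ?thesis
    unfolding M m power2_eq_square using A by (simp add: field_simps)
qed

text \<open>The second obstruction: the first one, differentiated along the gradient of \<open>K\<close>. As the Hessian
  of \<open>K\<close> is symmetric, \<open>X\<^sup>a \<nabla>\<^sup>b K \<nabla>\<^sub>a \<nabla>\<^sub>b K\<close> is half of \<open>X\<^sup>a \<nabla>\<^sub>a M\<close>, and all other derivatives are
  prescribed. The last summand carries \<open>8 e F K \<epsilon>\<^sub>a\<^sub>b X\<^sup>a \<nabla>\<^sup>b K\<close>; everything else is \<open>B\<close>.\<close>

lemma curvature_transport:
  assumes x: "x \<in> U"
  defines "\<sigma> \<equiv> contract G x (X x) (X x)"
    and "A \<equiv> contract G x (X x) (grad K x)"
    and "M \<equiv> \<lambda>y. contract G y (grad K y) (grad K y)"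
    and "\<mu> \<equiv> \<lambda>y. laplacian G K y / 6 + (K y)\<^sup>2 / 2"
    and "v \<equiv> (curl x)\<^sup>2 / det (G x)"
  shows "contract G x (X x) (grad M x) = 2 * A\<^sup>2 - K x * M x - 6 * A * v - 2 * A * (K x)\<^sup>2 + 4 * A * K x * \<sigma>
      - 2 * \<sigma> * M x - 2 * contract G x (grad K x) (grad \<mu> x)
      + 8 * curl x * K x * (raise G x (X x) $ 1 * raise G x (grad K x) $ 2 - raise G x (X x) $ 2 * raise G x (grad K x) $ 1)"
proof -
  note sm = smooth_grad[OF smooth_curvature]
  let ?H = "\<lambda>a. \<chi> b. nabla G (grad K) x a b" and ?N = "\<lambda>a. \<chi> b. nabla G X x a b"
  let ?\<Gamma> = "christoffel G"
  have s\<sigma>: "smooth_fun_on U (\<lambda>y. contract G y (X y) (X y))"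
    by (rule smooth_contract[OF smooth_X smooth_X])
  have s\<mu>: "smooth_fun_on U \<mu>"
    unfolding \<mu>_def by (intro smooth_intros smooth_cdivide smooth_laplacian smooth_curvature)
  have sv: "smooth_fun_on U (\<lambda>y. (curl y)\<^sup>2 / det (G y))"
    by (intro smooth_divide[OF U det_nz] smooth_intros smooth_curl smooth_det)
  have dM: "grad M x $ k = 2 * contract G x (?H k) (grad K x)" for k
    using partial_contract[OF x sm sm, of k] contract_commute[OF x, of "grad K x"]
    by (simp add: grad_nth M_def)
  have dv: "partial k (\<lambda>y. (curl y)\<^sup>2 / det (G y)) x
      = 2 * curl x * (partial k curl x - (?\<Gamma> x 1 k 1 + ?\<Gamma> x 2 k 2) * curl x) / det (G x)" for k
  proof -
    have "partial k (\<lambda>y. (curl y)\<^sup>2 / det (G y)) x = (partial k (\<lambda>y. (curl y)\<^sup>2) x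
        - (curl x)\<^sup>2 / det (G x) * partial k (\<lambda>y. det (G y)) x) / det (G x)"
      by (intro partial_divide[OF x det_nz] smooth_intros smooth_curl smooth_det)
    also have "\<dots> = (2 * curl x * partial k curl x
        - 2 * (?\<Gamma> x 1 k 1 + ?\<Gamma> x 2 k 2) * (curl x)\<^sup>2) / det (G x)"
      using det_nz[OF x] by (simp add: x partial_det)
    finally show ?thesis by (simp add: power2_eq_square algebra_simps)
  qed
  have d\<sigma>: "partial k (\<lambda>y. contract G y (X y) (X y)) x = 2 * contract G x (?N k) (X x)" for k
    using partial_contract[OF x smooth_X smooth_X, of k] contract_commute[OF x, of "X x"] by simp
  have key: "contract G x (?N k) (grad K x) + contract G x (X x) (?H k) =
      curl x * (partial k curl x - (?\<Gamma> x 1 k 1 + ?\<Gamma> x 2 k 2) * curl x) / det (G x)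
      - \<sigma> * partial k K x - 2 * contract G x (?N k) (X x) * K x - partial k \<mu> x" for k
  proof -
    have "partial k (\<lambda>y. contract G y (X y) (grad K y)) x =
        partial k (\<lambda>y. 1/2 * ((curl y)\<^sup>2 / det (G y)) - contract G y (X y) (X y) * K y - \<mu> y) x"
      by (rule partial_cong_open[OF U x]) (simp add: curl_integrability \<mu>_def)
    also have "\<dots> = 1/2 * partial k (\<lambda>y. (curl y)\<^sup>2 / det (G y)) x
        - (partial k (\<lambda>y. contract G y (X y) (X y)) x * K x + \<sigma> * partial k K x) - partial k \<mu> x"
      unfolding \<sigma>_def
      by (subst partial_diff partial_mult; (intro x smooth_intros smooth_curvature s\<sigma> s\<mu> sv)?)+ simp
    finally show ?thesis
      unfolding partial_contract[OF x smooth_X sm] dv d\<sigma> by simp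
  qed
  define k where "k = raise G x (grad K x)"
  define u where "u = raise G x (X x)"
  let ?p = "G x $ 1 $ 1" and ?q = "G x $ 1 $ 2" and ?r = "G x $ 2 $ 2" and ?w = "curl x"
  have C: "contract G x \<omega> (grad K x) = \<omega> $ 1 * k $ 1 + \<omega> $ 2 * k $ 2"
      "contract G x \<omega> (X x) = \<omega> $ 1 * u $ 1 + \<omega> $ 2 * u $ 2" for \<omega>
    by (simp_all add: contract_def sum_2 k_def u_def)
  have C': "contract G x (grad K x) \<omega> = contract G x \<omega> (grad K x)" "contract G x (X x) \<omega> = contract G x \<omega> (X x)" for \<omega>
    by (rule contract_commute[OF x])+
  have K12: "partial 1 K x = ?p * k $ 1 + ?q * k $ 2" "partial 2 K x = ?q * k $ 1 + ?r * k $ 2"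
    using lower_raise[OF x, of "grad K x" 1] lower_raise[OF x, of "grad K x" 2]
    by (simp_all add: grad_nth k_def G_21[OF x])
  have X12: "X x $ 1 = ?p * u $ 1 + ?q * u $ 2" "X x $ 2 = ?q * u $ 1 + ?r * u $ 2"
    using lower_raise[OF x, of "X x" 1] lower_raise[OF x, of "X x" 2]
    by (simp_all add: u_def G_21[OF x])
  have N: "contract G x (?N 1) (grad K x) = - X x $ 1 * A + K x / 2 * partial 1 K x + ?w / 2 * k $ 2"
    "contract G x (?N 2) (grad K x) = - X x $ 2 * A + K x / 2 * partial 2 K x - ?w / 2 * k $ 1"
    "contract G x (?N 1) (X x) = - X x $ 1 * \<sigma> + K x / 2 * X x $ 1 + ?w / 2 * u $ 2"
    "contract G x (?N 2) (X x) = - X x $ 2 * \<sigma> + K x / 2 * X x $ 2 - ?w / 2 * u $ 1"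
    unfolding A_def \<sigma>_def C K12
    by (simp_all add: nabla_X[OF x], simp_all add: X12 field_simps)
  \<comment> \<open>The covariant derivative of the density \<open>curl\<close>. In contravariant components the terms with
    the metric collapse to multiples of its determinant, which cancels after the division below.\<close>
  have dc: "partial 1 curl x - (?\<Gamma> x 1 1 1 + ?\<Gamma> x 2 1 2) * ?w = - 3 * ?w * X x $ 1 - det (G x) * (k $ 2 + 3 * K x * u $ 2)"
    "partial 2 curl x - (?\<Gamma> x 1 2 1 + ?\<Gamma> x 2 2 2) * ?w = - 3 * ?w * X x $ 2 + det (G x) * (k $ 1 + 3 * K x * u $ 1)"
    by (simp_all add: partial_curl[OF x] G_21[OF x] K12 det_G[OF x]) (simp_all add: X12 power2_eq_square algebra_simps)
  have dc': "?w * (partial 1 curl x - (?\<Gamma> x 1 1 1 + ?\<Gamma> x 2 1 2) * ?w) / det (G x)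
      = - 3 * v * X x $ 1 - ?w * (k $ 2 + 3 * K x * u $ 2)"
    "?w * (partial 2 curl x - (?\<Gamma> x 1 2 1 + ?\<Gamma> x 2 2 2) * ?w) / det (G x)
      = - 3 * v * X x $ 2 + ?w * (k $ 1 + 3 * K x * u $ 1)"
    unfolding dc v_def using det_nz[OF x] by (simp_all add: field_simps power2_eq_square)
  have "2 * (nabla G (grad K) x 1 1 * k $ 1 + nabla G (grad K) x 1 2 * k $ 2) * u $ 1
      + 2 * (nabla G (grad K) x 1 2 * k $ 1 + nabla G (grad K) x 2 2 * k $ 2) * u $ 2 =
    2 * A\<^sup>2 - K x * M x - 6 * A * v - 2 * A * (K x)\<^sup>2 + 4 * A * K x * \<sigma> - 2 * \<sigma> * M x
    - 2 * contract G x (grad K x) (grad \<mu> x) + 8 * ?w * K x * (u $ 1 * k $ 2 - u $ 2 * k $ 1)"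
  proof (rule transport_combination)
    show "A = X x $ 1 * k $ 1 + X x $ 2 * k $ 2"
      by (simp add: A_def C)
    show "M x = partial 1 K x * k $ 1 + partial 2 K x * k $ 2"
      by (simp add: M_def C grad_nth)
    show "contract G x (grad K x) (grad \<mu> x) = partial 1 \<mu> x * k $ 1 + partial 2 \<mu> x * k $ 2"
      unfolding C'(1) by (simp add: C grad_nth)
    show "- X x $ 1 * A + K x / 2 * partial 1 K x + ?w / 2 * k $ 2
        + (nabla G (grad K) x 1 1 * u $ 1 + nabla G (grad K) x 1 2 * u $ 2) =
      - 3 * v * X x $ 1 - ?w * (k $ 2 + 3 * K x * u $ 2) - \<sigma> * partial 1 K x
        - 2 * (- X x $ 1 * \<sigma> + K x / 2 * X x $ 1 + ?w / 2 * u $ 2) * K x - partial 1 \<mu> x"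
      using key[of 1] unfolding N dc' C'(2) by (simp add: C)
    show "- X x $ 2 * A + K x / 2 * partial 2 K x - ?w / 2 * k $ 1
        + (nabla G (grad K) x 1 2 * u $ 1 + nabla G (grad K) x 2 2 * u $ 2) =
      - 3 * v * X x $ 2 + ?w * (k $ 1 + 3 * K x * u $ 1) - \<sigma> * partial 2 K x
        - 2 * (- X x $ 2 * \<sigma> + K x / 2 * X x $ 2 - ?w / 2 * u $ 1) * K x - partial 2 \<mu> x"
      using key[of 2] hessian_sym[OF x smooth_curvature] unfolding N dc' C'(2) by (simp add: C)
  qed
  moreover have "contract G x (X x) (grad M x) =
      2 * (nabla G (grad K) x 1 1 * k $ 1 + nabla G (grad K) x 1 2 * k $ 2) * u $ 1
      + 2 * (nabla G (grad K) x 1 2 * k $ 1 + nabla G (grad K) x 2 2 * k $ 2) * u $ 2"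
    unfolding C'(2) C dM using hessian_sym[OF x smooth_curvature] by simp
  ultimately show ?thesis
    unfolding k_def u_def by simp
qed

end

section \<open>Solving the two obstructions\<close>

text \<open>The two obstructions are linear equations for \<open>X\<close>, once the term \<open>t (x1 k2 - x2 k1)\<close> is moved
  to the unknowns; the determinant of the system is \<open>J\<close> up to a nonzero factor, so \<open>X\<close> is determined.
  Decomposing it along the gradient \<open>(k1, k2)\<close> and the orthogonal direction diagonalises the
  first equation, and the squared length of the solution is the relation for \<open>\<sigma>\<close>. Here
  \<open>s\<close> stands for \<open>sqrt \<bar>D\<bar>\<close> and \<open>p\<close>, \<open>q\<close>, \<open>r\<close> are the components of the metric, which lowers
  the indices of \<open>(x1, x2)\<close> and \<open>(k1, k2)\<close>.\<close>

lemma solve_in_gradient_frame: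
  fixes p q r D e s x1 x2 k1 k2 M1 M2 A B t J :: real
  defines "X1 \<equiv> p * x1 + q * x2" and "X2 \<equiv> q * x1 + r * x2"
    and "K1 \<equiv> p * k1 + q * k2" and "K2 \<equiv> q * k1 + r * k2"
  defines "M \<equiv> K1 * k1 + K2 * k2" and "N \<equiv> M1 * k1 + M2 * k2" and "\<sigma> \<equiv> X1 * x1 + X2 * x2"
  assumes D: "D = p * r - q\<^sup>2" and s: "s * s = e * D" and e: "e * e = 1"
    and A: "A = X1 * k1 + X2 * k2"
    and B: "M1 * x1 + M2 * x2 = B + t * (x1 * k2 - x2 * k1)"
    and J: "J * D = s * (K1 * M2 - K2 * M1 + t * M)"
    and nz: "D \<noteq> 0" "M \<noteq> 0" "J \<noteq> 0"
  shows "X1 = (A * N - M * B) / (M * J) * (s * k2) + A / M * K1"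
    and "X2 = - ((A * N - M * B) / (M * J) * (s * k1)) + A / M * K2"
    and "M * J\<^sup>2 * \<sigma> = e * (A * N - M * B)\<^sup>2 + A\<^sup>2 * J\<^sup>2"
proof -
  define L where "L = K1 * M2 - K2 * M1 + t * M"
  define P where "P = A * N - M * B"
  have B': "B = M1 * x1 + M2 * x2 - t * (x1 * k2 - x2 * k1)" using B by simp
  have s0: "s \<noteq> 0" using s e nz by auto
  have sJ: "s * J = e * L"
  proof -
    have "D * (s * J) = D * (e * L)" using J s unfolding L_def by algebra
    then show ?thesis using nz by simp
  qed
  have 1: "L * (M * X1) = D * (P * k2) + L * (A * K1)" and 2: "L * (M * X2) = - (D * (P * k1)) + L * (A * K2)"
    unfolding L_def P_def B' A N_def M_def X1_def X2_def K1_def K2_def D by algebra+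
  have "s * (M * J * X1) = s * (P * (s * k2) + A * J * K1)" "s * (M * J * X2) = s * (- (P * (s * k1)) + A * J * K2)"
    using 1 2 sJ s by algebra+
  then have X: "M * J * X1 = P * (s * k2) + A * J * K1" "M * J * X2 = - (P * (s * k1)) + A * J * K2"
    using s0 by simp_all
  then show "X1 = (A * N - M * B) / (M * J) * (s * k2) + A / M * K1"
    "X2 = - ((A * N - M * B) / (M * J) * (s * k1)) + A / M * K2"
    using nz unfolding P_def[symmetric] by (simp_all add: field_simps)
  \<comment> \<open>The inverse metric, multiplied by \<open>D\<close>, is \<open>(r, -q, p)\<close>.\<close>
  have "D * \<sigma> = r * X1\<^sup>2 - 2 * q * X1 * X2 + p * X2\<^sup>2"
    unfolding \<sigma>_def X1_def X2_def D by algebra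
  then have "D * (M * J)\<^sup>2 * \<sigma> = r * (M * J * X1)\<^sup>2 - 2 * q * (M * J * X1) * (M * J * X2) + p * (M * J * X2)\<^sup>2"
    by algebra
  also have "\<dots> = P\<^sup>2 * (s * s) * M + (A * J)\<^sup>2 * (D * M)"
    unfolding X unfolding M_def K1_def K2_def D by algebra
  finally have "(D * M) * (M * J\<^sup>2 * \<sigma>) = (D * M) * (e * P\<^sup>2 + A\<^sup>2 * J\<^sup>2)"
    unfolding s by algebra
  then show "M * J\<^sup>2 * \<sigma> = e * (A * N - M * B)\<^sup>2 + A\<^sup>2 * J\<^sup>2"
    using nz unfolding P_def by simp
qed

text \<open>The quadratic part of \<open>B\<close> is \<open>2 k\<^sup>2 - 4 k\<^sup>2 = - 2 k\<^sup>2\<close>, so the quartic relation has leading coefficient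
  \<open>- e (2 M k\<^sup>2)\<^sup>2\<close>, and all degrees are attained as soon as \<open>k \<noteq> 0\<close>.\<close>

lemma quartic_polynomial:
  fixes A B :: "real \<Rightarrow> real"
  assumes A: "\<And>s. A s = a - s * k" and B: "\<And>s. B s = 2 * (A s)\<^sup>2 + b * A s + 4 * A s * k * s - 2 * s * M + c"
    and nz: "M \<noteq> 0" "e \<noteq> 0"
  shows "\<exists>p q r :: real poly.
    (\<forall>s. poly p s = A s) \<and> degree p \<le> 1 \<and>
    (\<forall>s. poly q s = B s) \<and> degree q \<le> 2 \<and>
    (\<forall>s. poly r s = M * J\<^sup>2 * s - (e * (A s * N - M * B s)\<^sup>2 + (A s)\<^sup>2 * J\<^sup>2)) \<and> degree r \<le> 4 \<and>
    (k \<noteq> 0 \<longrightarrow> degree p = 1 \<and> degree q = 2 \<and> degree r = 4)"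
proof -
  define q0 q1 where "q0 = 2 * a\<^sup>2 + b * a + c" and "q1 = - b * k - 2 * M"
  define u0 u1 u2 where "u0 = a * N - M * q0" and "u1 = - k * N - M * q1" and "u2 = 2 * M * k\<^sup>2"
  define p q r where "p = [:a, - k:]" and "q = [:q0, q1, - 2 * k\<^sup>2:]"
    and "r = [:- (e * u0\<^sup>2 + a\<^sup>2 * J\<^sup>2), M * J\<^sup>2 - 2 * e * u0 * u1 + 2 * a * k * J\<^sup>2,
          - (e * (u1\<^sup>2 + 2 * u0 * u2) + k\<^sup>2 * J\<^sup>2), - 2 * e * u1 * u2, - (e * u2\<^sup>2):]"
  have q: "poly q s = B s" for s
    unfolding B A q_def q0_def q1_def by (simp add: power2_eq_square algebra_simps)
  have u: "A s * N - M * B s = u0 + u1 * s + u2 * s\<^sup>2" for s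
    unfolding q[symmetric] A q_def u0_def u1_def u2_def by (simp add: power2_eq_square algebra_simps)
  have "poly r s = M * J\<^sup>2 * s - (e * (A s * N - M * B s)\<^sup>2 + (A s)\<^sup>2 * J\<^sup>2)" for s
  proof -
    have "poly r s = M * J\<^sup>2 * s - (e * (u0 + u1 * s + u2 * s\<^sup>2)\<^sup>2 + (a - s * k)\<^sup>2 * J\<^sup>2)"
      unfolding r_def by (simp add: power2_eq_square algebra_simps)
    then show ?thesis unfolding u by (simp add: A)
  qed
  moreover have "poly p s = A s" for s
    by (simp add: p_def A)
  moreover have "degree p \<le> 1" "degree q \<le> 2" "degree r \<le> 4"
    unfolding p_def q_def r_def by (rule degree_le, simp add: coeff_pCons split: nat.split)+
  moreover have "k \<noteq> 0 \<longrightarrow> degree p = 1 \<and> degree q = 2 \<and> degree r = 4"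
    using nz by (simp add: p_def q_def r_def u2_def)
  ultimately show ?thesis using q by blast
qed

section \<open>The formula for \<open>X\<close> and the quartic\<close>

context soliton_chart
begin

lemma pointwise_formula:
  assumes x: "x \<in> U"
  defines "s \<equiv> sqrt \<bar>det (G x)\<bar>"
    and "F \<equiv> \<Sum>a\<in>UNIV. \<Sum>b\<in>UNIV. vol_up G x a b * nabla G X x a b"
    and "\<sigma> \<equiv> contract G x (X x) (X x)"
    and "M \<equiv> \<lambda>y. contract G y (grad K y) (grad K y)"
    and "\<mu> \<equiv> \<lambda>y. laplacian G K y / 6 + (K y)\<^sup>2 / 2"
  defines "\<rho> \<equiv> \<Sum>a\<in>UNIV. \<Sum>b\<in>UNIV. vol_up G x a b * grad K x $ a * grad M x $ b"
    and "N \<equiv> contract G x (grad K x) (grad M x)"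
    and "A \<equiv> e / 2 * F\<^sup>2 - \<sigma> * K x - \<mu> x"
  defines "B \<equiv> 2 * A\<^sup>2 - K x * M x - 6 * e * A * F\<^sup>2 - 2 * A * (K x)\<^sup>2 + 4 * A * K x * \<sigma> - 2 * \<sigma> * M x
      - 2 * contract G x (grad K x) (grad \<mu> x)"
    and "J \<equiv> \<rho> + 8 * K x * F * M x"
  assumes nz: "J \<noteq> 0" "M x \<noteq> 0"
  shows "X x $ a = (A * N - M x * B) / (M x * J) * (\<Sum>b\<in>UNIV. vol G x a b * raise G x (grad K x) $ b)
      + A / M x * grad K x $ a"
    and "M x * J\<^sup>2 * \<sigma> = e * (A * N - M x * B)\<^sup>2 + A\<^sup>2 * J\<^sup>2"
proof -
  define D where "D = det (G x)"
  define k u where "k = raise G x (grad K x)" and "u = raise G x (X x)"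
  let ?p = "G x $ 1 $ 1" and ?q = "G x $ 1 $ 2" and ?r = "G x $ 2 $ 2" and ?t = "8 * curl x * K x"
  have D: "D \<noteq> 0" "D = ?p * ?r - ?q\<^sup>2"
    using det_nz[OF x] det_G[OF x] by (simp_all add: D_def)
  have ee: "e * e = 1" using e by auto
  have abs: "\<bar>det (G x)\<bar> = e * D"
    using e e_det[OF x] by (auto simp: D_def)
  \<comment> \<open>As \<open>e\<close> is the sign of \<open>D\<close>, the volume density enters only through \<open>s\<^sup>2 = e D\<close>.\<close>
  have s: "s * s = e * D"
    unfolding s_def abs using e_det[OF x] by (simp add: D_def)
  have F: "F = s / D * curl x"
    unfolding F_def vol_up_eq[OF x] by (simp add: s_def D_def nabla_X[OF x])
  have eF: "e * F\<^sup>2 = (curl x)\<^sup>2 / D"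
  proof -
    have "e * F\<^sup>2 = e * (s * s) * (curl x)\<^sup>2 / (D * D)"
      by (simp add: F power2_eq_square)
    also have "\<dots> = (e * e) * D * (curl x)\<^sup>2 / (D * D)"
      unfolding s by simp
    finally show ?thesis using D(1) by (simp add: ee)
  qed
  have C: "contract G x \<omega> (grad K x) = \<omega> $ 1 * k $ 1 + \<omega> $ 2 * k $ 2"
      "contract G x \<omega> (X x) = \<omega> $ 1 * u $ 1 + \<omega> $ 2 * u $ 2" for \<omega>
    by (simp_all add: contract_def sum_2 k_def u_def)
  have C': "contract G x (grad K x) \<omega> = contract G x \<omega> (grad K x)" "contract G x (X x) \<omega> = contract G x \<omega> (X x)" for \<omega>
    by (rule contract_commute[OF x])+
  have K12: "grad K x $ 1 = ?p * k $ 1 + ?q * k $ 2" "grad K x $ 2 = ?q * k $ 1 + ?r * k $ 2"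
    using lower_raise[OF x, of "grad K x" 1] lower_raise[OF x, of "grad K x" 2]
    by (simp_all add: k_def G_21[OF x])
  have X12: "X x $ 1 = ?p * u $ 1 + ?q * u $ 2" "X x $ 2 = ?q * u $ 1 + ?r * u $ 2"
    using lower_raise[OF x, of "X x" 1] lower_raise[OF x, of "X x" 2]
    by (simp_all add: u_def G_21[OF x])
  have A: "A = contract G x (X x) (grad K x)"
    unfolding curl_integrability[OF x] A_def \<sigma>_def \<mu>_def using eF by (simp add: D_def)
  have B: "contract G x (X x) (grad M x) = B + ?t * (u $ 1 * k $ 2 - u $ 2 * k $ 1)"
  proof -
    have "6 * e * A * F\<^sup>2 = 6 * A * (e * F\<^sup>2)" by simp
    then show ?thesis
      using curvature_transport[OF x] unfolding B_def A \<sigma>_def M_def \<mu>_def eF D_def u_def k_def by simp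
  qed
  have \<rho>: "\<rho> = s / D * (grad K x $ 1 * grad M x $ 2 - grad K x $ 2 * grad M x $ 1)"
    using vol_up_eq[OF x, of "\<lambda>a b. grad K x $ a * grad M x $ b"]
    by (simp add: \<rho>_def s_def D_def mult.assoc)
  have M: "M x = grad K x $ 1 * k $ 1 + grad K x $ 2 * k $ 2"
    by (simp add: M_def C)
  have J: "J * D = s * (grad K x $ 1 * grad M x $ 2 - grad K x $ 2 * grad M x $ 1 + ?t * M x)"
    unfolding J_def \<rho> F using D(1) by (simp add: field_simps)
  note solution = solve_in_gradient_frame[OF D(2) s ee, of A "u $ 1" "u $ 2" "k $ 1" "k $ 2" "grad M x $ 1" "grad M x $ 2" B ?t J,
    folded K12 X12, folded M, OF _ _ J D(1) nz(2) nz(1)]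
  have hyps: "A = X x $ 1 * k $ 1 + X x $ 2 * k $ 2"
    "grad M x $ 1 * u $ 1 + grad M x $ 2 * u $ 2 = B + ?t * (u $ 1 * k $ 2 - u $ 2 * k $ 1)"
    using A B unfolding C' C by simp_all
  have N: "N = grad M x $ 1 * k $ 1 + grad M x $ 2 * k $ 2"
    unfolding N_def C' C ..
  have vol: "(\<Sum>b\<in>UNIV. vol G x 1 b * k $ b) = s * k $ 2" "(\<Sum>b\<in>UNIV. vol G x 2 b * k $ b) = - (s * k $ 1)"
    by (simp_all add: sum_2 vol_def s_def)
  show "X x $ a = (A * N - M x * B) / (M x * J) * (\<Sum>b\<in>UNIV. vol G x a b * raise G x (grad K x) $ b)
      + A / M x * grad K x $ a"
    using exhaust_2[of a] solution(1,2)[OF hyps] vol unfolding k_def[symmetric] N by auto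
  show "M x * J\<^sup>2 * \<sigma> = e * (A * N - M x * B)\<^sup>2 + A\<^sup>2 * J\<^sup>2"
    using solution(3)[OF hyps] unfolding N \<sigma>_def C .
qed

end

section \<open>From the surface to a chart\<close>

text \<open>Evaluating the form on \<open>(1, 0)\<close> and on the vector \<open>(- M\<^sub>1\<^sub>2, M\<^sub>1\<^sub>1)\<close> orthogonal to it gives
  \<open>M\<^sub>1\<^sub>1\<close> and \<open>M\<^sub>1\<^sub>1 det M\<close>.\<close>

lemma riemannian_det_pos:
  fixes M :: "real^2^2"
  assumes sym: "M $ 2 $ 1 = M $ 1 $ 2" and pos: "\<And>v. v \<noteq> 0 \<Longrightarrow> v \<bullet> (M *v v) > 0"
  shows "det M > 0"
proof -
  have Q: "v \<bullet> (M *v v) = M$1$1 * (v$1)\<^sup>2 + 2 * M$1$2 * v$1 * v$2 + M$2$2 * (v$2)\<^sup>2" for v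
    by (simp add: inner_vec_def matrix_vector_mult_def sum_2 sym power2_eq_square algebra_simps)
  have a: "M $ 1 $ 1 > 0"
    using pos[of "vector [1, 0]"] unfolding Q by (simp add: vec_eq_iff forall_2 vector_2)
  then have "M$1$1 * det M > 0"
    using pos[of "vector [- M$1$2, M$1$1]"] unfolding Q
    by (simp add: vec_eq_iff forall_2 vector_2 det_2 sym power2_eq_square algebra_simps)
  then show ?thesis using a by (simp add: zero_less_mult_iff)
qed

text \<open>The Gram determinant of \<open>u\<close> and \<open>v\<close> is \<open>det M\<close> times a square.\<close>

lemma lorentzian_det_neg:
  fixes M :: "real^2^2"
  assumes sym: "M $ 2 $ 1 = M $ 1 $ 2" and "u \<bullet> (M *v u) = 1" "v \<bullet> (M *v v) = -1" "u \<bullet> (M *v v) = 0"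
  shows "det M < 0"
proof -
  have Q: "a \<bullet> (M *v b) = M$1$1 * (a$1 * b$1) + M$1$2 * (a$1 * b$2 + a$2 * b$1) + M$2$2 * (a$2 * b$2)" for a b
    by (simp add: inner_vec_def matrix_vector_mult_def sum_2 sym algebra_simps)
  have "det M * (u$1 * v$2 - u$2 * v$1)\<^sup>2 = (u \<bullet> (M *v u)) * (v \<bullet> (M *v v)) - (u \<bullet> (M *v v))\<^sup>2"
    unfolding Q det_2 sym by algebra
  then have "det M * (u$1 * v$2 - u$2 * v$1)\<^sup>2 = -1"
    using assms by simp
  then show ?thesis
    by (metis mult_nonneg_nonneg not_less zero_le_power2 neg_0_le_iff_le not_one_le_zero)
qed

lemma soliton_chartI:
  assumes surface: "oriented_surface \<A>"
    and metric: "(riemannian_metric \<A> g \<and> e = 1) \<or> (lorentzian_metric \<A> g \<and> e = -1)"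
    and form: "one_form \<A> X"
    and soliton: "\<forall>c\<in>\<A>. \<forall>x\<in>coord_domain c. \<forall>a b.
      (nabla (g c) (X c) x a b + nabla (g c) (X c) x b a) / 2
        + X c x $ a * X c x $ b - gauss_curvature (g c) x / 2 * g c x $ a $ b = 0"
    and c: "c \<in> \<A>"
  shows "soliton_chart (coord_domain c) (g c) e (X c)"
proof
  have t: "symmetric_2_tensor \<A> g"
    using metric unfolding riemannian_metric_def lorentzian_metric_def by blast
  then show "smooth_fun_on (coord_domain c) (\<lambda>y. g c y $ i $ j)" for i j
    using c unfolding symmetric_2_tensor_def by blast
  have tr: "transpose (g c y) = g c y" if "y \<in> coord_domain c" for y
    using t c that unfolding symmetric_2_tensor_def by blast
  show sym: "g c y $ i $ j = g c y $ j $ i" if "y \<in> coord_domain c" for y i j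
    using arg_cong[OF tr[OF that], of "\<lambda>M. M $ j $ i"] by (simp add: transpose_def)
  show "open (coord_domain c)"
    using surface c unfolding oriented_surface_def by blast
  show "e = 1 \<or> e = -1" using metric by blast
  show "e * det (g c y) > 0" if y: "y \<in> coord_domain c" for y
    using metric
  proof
    assume "riemannian_metric \<A> g \<and> e = 1"
    then show ?thesis
      using riemannian_det_pos[OF sym[OF y]] c y unfolding riemannian_metric_def by auto
  next
    assume "lorentzian_metric \<A> g \<and> e = -1"
    then show ?thesis
      using lorentzian_det_neg[OF sym[OF y]] c y unfolding lorentzian_metric_def by fastforce
  qed
  show "smooth_fun_on (coord_domain c) (\<lambda>y. X c y $ i)" for i
    using form c unfolding one_form_def by blast
  show "(nabla (g c) (X c) x a b + nabla (g c) (X c) x b a) / 2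
      + X c x $ a * X c x $ b - gauss_curvature (g c) x / 2 * g c x $ a $ b = 0"
    if "x \<in> coord_domain c" for x a b
    using soliton c that by blast
qed

theorem proposition3p13:
  fixes \<A> :: "'a::{t2_space, second_countable_topology} chart set"
    and g :: "'a chart \<Rightarrow> real^2 \<Rightarrow> real^2^2"
    and X :: "'a chart \<Rightarrow> real^2 \<Rightarrow> real^2"
    and e :: real
  assumes surface: "oriented_surface \<A>"
    and metric: "(riemannian_metric \<A> g \<and> e = 1) \<or> (lorentzian_metric \<A> g \<and> e = -1)"
    and form: "one_form \<A> X"
    and soliton: "\<forall>c\<in>\<A>. \<forall>x\<in>coord_domain c. \<forall>a b.
      (nabla (g c) (X c) x a b + nabla (g c) (X c) x b a) / 2
        + X c x $ a * X c x $ b - gauss_curvature (g c) x / 2 * g c x $ a $ b = 0"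
  shows "\<forall>c\<in>\<A>. \<forall>x\<in>coord_domain c.
    (let G = g c;
         K = gauss_curvature G;
         F = (\<Sum>a\<in>UNIV. \<Sum>b\<in>UNIV. vol_up G x a b * nabla G (X c) x a b);
         \<sigma> = contract G x (X c x) (X c x);
         M = (\<lambda>y. contract G y (grad K y) (grad K y));
         \<rho> = (\<Sum>a\<in>UNIV. \<Sum>b\<in>UNIV. vol_up G x a b * grad K x $ a * grad M x $ b);
         N = contract G x (grad K x) (grad M x);
         \<mu> = (\<lambda>y. laplacian G K y / 6 + (K y)\<^sup>2 / 2);
         J = \<rho> + 8 * K x * F * M x;
         A = (\<lambda>s. e / 2 * F\<^sup>2 - s * K x - \<mu> x);
         B = (\<lambda>s. 2 * (A s)\<^sup>2 - K x * M x - 6 * e * A s * F\<^sup>2 - 2 * A s * (K x)\<^sup>2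
                    + 4 * A s * K x * s - 2 * s * M x
                    - 2 * contract G x (grad K x) (grad \<mu> x))
     in J \<noteq> 0 \<and> M x \<noteq> 0 \<longrightarrow>
        (\<forall>a. X c x $ a =
           (A \<sigma> * N - M x * B \<sigma>) / (M x * (\<rho> + 8 * K x * F * M x))
             * (\<Sum>b\<in>UNIV. vol G x a b * raise G x (grad K x) $ b)
           + A \<sigma> / M x * grad K x $ a) \<and>
        M x * J\<^sup>2 * \<sigma> = e * (A \<sigma> * N - M x * B \<sigma>)\<^sup>2 + (A \<sigma>)\<^sup>2 * J\<^sup>2 \<and>
        (\<exists>p q r :: real poly.
           (\<forall>s. poly p s = A s) \<and> degree p \<le> 1 \<and>
           (\<forall>s. poly q s = B s) \<and> degree q \<le> 2 \<and>
           (\<forall>s. poly r s = M x * J\<^sup>2 * s - (e * (A s * N - M x * B s)\<^sup>2 + (A s)\<^sup>2 * J\<^sup>2)) \<and>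
           degree r \<le> 4 \<and> poly r \<sigma> = 0 \<and>
           (K x \<noteq> 0 \<longrightarrow> degree p = 1 \<and> degree q = 2 \<and> degree r = 4)))"
proof (intro ballI, goal_cases)
  case (1 c x)
  note x = \<open>x \<in> coord_domain c\<close>
  interpret soliton_chart "coord_domain c" "g c" e "X c"
    by (rule soliton_chartI[OF surface metric form soliton \<open>c \<in> \<A>\<close>])
  define G where "G = g c"
  define K where "K = gauss_curvature G"
  define F where "F = (\<Sum>a\<in>UNIV. \<Sum>b\<in>UNIV. vol_up G x a b * nabla G (X c) x a b)"
  define \<sigma> where "\<sigma> = contract G x (X c x) (X c x)"
  define M where "M = (\<lambda>y. contract G y (grad K y) (grad K y))"
  define \<rho> where "\<rho> = (\<Sum>a\<in>UNIV. \<Sum>b\<in>UNIV. vol_up G x a b * grad K x $ a * grad M x $ b)"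
  define N where "N = contract G x (grad K x) (grad M x)"
  define \<mu> where "\<mu> = (\<lambda>y. laplacian G K y / 6 + (K y)\<^sup>2 / 2)"
  define J where "J = \<rho> + 8 * K x * F * M x"
  define A where "A = (\<lambda>s. e / 2 * F\<^sup>2 - s * K x - \<mu> x)"
  define B where "B = (\<lambda>s. 2 * (A s)\<^sup>2 - K x * M x - 6 * e * A s * F\<^sup>2 - 2 * A s * (K x)\<^sup>2
                    + 4 * A s * K x * s - 2 * s * M x
                    - 2 * contract G x (grad K x) (grad \<mu> x))"
  note defs = A_def B_def J_def \<mu>_def N_def \<rho>_def M_def \<sigma>_def F_def K_def G_def
  have formula: "X c x $ a = (A \<sigma> * N - M x * B \<sigma>) / (M x * J) * (\<Sum>b\<in>UNIV. vol G x a b * raise G x (grad K x) $ b)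
      + A \<sigma> / M x * grad K x $ a"
    and quartic: "M x * J\<^sup>2 * \<sigma> = e * (A \<sigma> * N - M x * B \<sigma>)\<^sup>2 + (A \<sigma>)\<^sup>2 * J\<^sup>2"
    if "J \<noteq> 0" "M x \<noteq> 0" for a
    using pointwise_formula[OF x] that unfolding defs by blast+
  have poly: "\<exists>p q r :: real poly.
           (\<forall>s. poly p s = A s) \<and> degree p \<le> 1 \<and>
           (\<forall>s. poly q s = B s) \<and> degree q \<le> 2 \<and>
           (\<forall>s. poly r s = M x * J\<^sup>2 * s - (e * (A s * N - M x * B s)\<^sup>2 + (A s)\<^sup>2 * J\<^sup>2)) \<and> degree r \<le> 4 \<and>
           (K x \<noteq> 0 \<longrightarrow> degree p = 1 \<and> degree q = 2 \<and> degree r = 4)"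
    if "M x \<noteq> 0"
  proof (rule quartic_polynomial)
    show "A s = (e / 2 * F\<^sup>2 - \<mu> x) - s * K x" for s
      by (simp add: A_def)
    show "B s = 2 * (A s)\<^sup>2 + (- 6 * e * F\<^sup>2 - 2 * (K x)\<^sup>2) * A s + 4 * A s * K x * s - 2 * s * M x
        + (- K x * M x - 2 * contract G x (grad K x) (grad \<mu> x))" for s
      by (simp add: B_def algebra_simps)
    show "M x \<noteq> 0" "e \<noteq> 0" using that e by auto
  qed
  have "J \<noteq> 0 \<and> M x \<noteq> 0 \<longrightarrow>
        (\<forall>a. X c x $ a =
           (A \<sigma> * N - M x * B \<sigma>) / (M x * (\<rho> + 8 * K x * F * M x))
             * (\<Sum>b\<in>UNIV. vol G x a b * raise G x (grad K x) $ b)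
           + A \<sigma> / M x * grad K x $ a) \<and>
        M x * J\<^sup>2 * \<sigma> = e * (A \<sigma> * N - M x * B \<sigma>)\<^sup>2 + (A \<sigma>)\<^sup>2 * J\<^sup>2 \<and>
        (\<exists>p q r :: real poly.
           (\<forall>s. poly p s = A s) \<and> degree p \<le> 1 \<and>
           (\<forall>s. poly q s = B s) \<and> degree q \<le> 2 \<and>
           (\<forall>s. poly r s = M x * J\<^sup>2 * s - (e * (A s * N - M x * B s)\<^sup>2 + (A s)\<^sup>2 * J\<^sup>2)) \<and>
           degree r \<le> 4 \<and> poly r \<sigma> = 0 \<and>
           (K x \<noteq> 0 \<longrightarrow> degree p = 1 \<and> degree q = 2 \<and> degree r = 4))"
  proof (intro impI, elim conjE, intro conjI allI)
    assume nz: "J \<noteq> 0" "M x \<noteq> 0"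
    show "X c x $ a = (A \<sigma> * N - M x * B \<sigma>) / (M x * (\<rho> + 8 * K x * F * M x))
             * (\<Sum>b\<in>UNIV. vol G x a b * raise G x (grad K x) $ b)
           + A \<sigma> / M x * grad K x $ a" for a
      using formula[OF nz] unfolding J_def .
    show q: "M x * J\<^sup>2 * \<sigma> = e * (A \<sigma> * N - M x * B \<sigma>)\<^sup>2 + (A \<sigma>)\<^sup>2 * J\<^sup>2"
      by (rule quartic[OF nz])
    obtain p q r :: "real poly" where pqr: "\<forall>s. poly p s = A s" "degree p \<le> 1"
        "\<forall>s. poly q s = B s" "degree q \<le> 2"
        "\<forall>s. poly r s = M x * J\<^sup>2 * s - (e * (A s * N - M x * B s)\<^sup>2 + (A s)\<^sup>2 * J\<^sup>2)" "degree r \<le> 4"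
        "K x \<noteq> 0 \<longrightarrow> degree p = 1 \<and> degree q = 2 \<and> degree r = 4"
      using poly[OF nz(2)] by blast
    moreover have "poly r \<sigma> = 0"
      using pqr(5) q by simp
    ultimately show "\<exists>p q r :: real poly.
           (\<forall>s. poly p s = A s) \<and> degree p \<le> 1 \<and>
           (\<forall>s. poly q s = B s) \<and> degree q \<le> 2 \<and>
           (\<forall>s. poly r s = M x * J\<^sup>2 * s - (e * (A s * N - M x * B s)\<^sup>2 + (A s)\<^sup>2 * J\<^sup>2)) \<and>
           degree r \<le> 4 \<and> poly r \<sigma> = 0 \<and>
           (K x \<noteq> 0 \<longrightarrow> degree p = 1 \<and> degree q = 2 \<and> degree r = 4)"
      by blast
  qed
  then show ?case
    unfolding Let_def defs .
qed

end
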